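(* Let $r\ge 1$, let $1\le i\le r$, let $V=V_{\bar 0}\oplus V_{\bar 1}$ be a $\mathbb{Z}/2\mathbb{Z}$-graded complex vector space, and let $R=\mathbb{C}[\mathbf{T}]V$ and $\overline{R}_i=\mathbb{C}[\overline{\mathbf{T}}_i]V$ be the free modules over $V$. Giving an $r$-dim $i$-linear Lie conformal superalgebra structure on $R$ is equivalent to giving on $\overline{R}_i$ an $(r-1)$-dim (left) Novikov conformal superalgebra structure with $\overline{\lambda}_i$-product $a_{\overline{\lambda}_i}b$, together with an $(r-1)$-dim Lie conformal superalgebra structure with $\overline{\lambda}_i$-bracket $[a_{\overline{\lambda}_i}b]$, which satisfy $$[(a_{-\overline{\mu}_i-\overline{\mathbf{T}}_i}b)_{-\overline{\lambda}_i-\overline{\mathbf{T}}_i}c] +[a_{-\overline{\mu}_i-\overline{\mathbf{T}}_i}b]_{-\overline{\lambda}_i-\overline{\mathbf{T}}_i}c -a_{-\overline{\lambda}_i-\overline{\mu}_i-\overline{\mathbf{T}}_i}[b_{-\overline{\lambda}_i-\overline{\mathbf{T}}_i}c] -(-1)^{\beta\gamma}[(a_{-\overline{\lambda}_i-\overline{\mathbf{T}}_i}c)_{-\overline{\mu}_i-\overline{\mathbf{T}}_i}b] -(-1)^{\beta\gamma}[a_{-\overline{\lambda}_i-\overline{\mathbf{T}}_i}c]_{-\overline{\mu}_i-\overline{\mathbf{T}}_i}b=0$$ for all $a\in V$, $b\in V_\beta$, $c\in V_\gamma$. The equivalence is the bijection between such structures on $R$ and such pairs of structures on $\overline{R}_i$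 determined by $$[a_{\lambda}b]=T_i\big((-1)^{\alpha\beta}\,b_{-\overline{\lambda}_i-\overline{\mathbf{T}}_i}a\big)+\lambda_i\big((-1)^{\alpha\beta}\,b_{-\overline{\lambda}_i-\overline{\mathbf{T}}_i}a+a_{\overline{\lambda}_i}b\big)+[a_{\overline{\lambda}_i}b],\qquad a\in V_\alpha,\ b\in V_\beta .$$
   Context: Base field $\mathbb{C}$. Put $\mathbf{T}=(T_1,\dots,T_r)$, $\lambda=(\lambda_1,\dots,\lambda_r)$, $\mathbb{C}[\mathbf{T}]=\mathbb{C}[T_1,\dots,T_r]$; $\overline{\mathbf{T}}_i$, $\overline{\lambda}_i$, $\overline{\mu}_i$ denote $\mathbf{T},\lambda,\mu$ with the $i$-th entry omitted. $\mathbb{C}[\mathbf{T}]V$ means $\mathbb{C}[\mathbf{T}]\otimes_{\mathbb{C}}V$, graded by the grading of $V$. All module actions preserve the grading, and all brackets and products are parity preserving. The definitions below are given for $n$ variables $\mathbf{T}=(T_1,\dots,T_n)$, $\lambda=(\lambda_1,\dots,\lambda_n)$, $\mu=(\mu_1,\dots,\mu_n)$ (they are used for $n=r$ and for $n=r-1$, the $r-1$ variables then being $\overline{\mathbf{T}}_i,\overline{\lambda}_i,\overline{\mu}_i$). For $n=0$ there are no variables and one obtains an ordinary Lie superalgebra, respectively left Novikov superalgebra, over $\mathbb{C}$. An $n$-dim Lie conformal superalgebra is a $\mathbb{Z}/2\mathbb{Z}$-graded $\mathbb{C}[\mathbf{T}]$-module $R=R_{\bar0}\oplus R_{\bar1}$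 with a $\mathbb{C}$-bilinear map $R\otimes R\to R[\lambda]=\mathbb{C}[\lambda_1,\dots,\lambda_n]\otimes R$, $a\otimes b\mapsto [a_\lambda b]$, such that for all $j$ and $a\in R_\alpha$, $b\in R_\beta$, $c\in R$: $[T_ja_\lambda b]=-\lambda_j[a_\lambda b]$, $[a_\lambda T_jb]=(T_j+\lambda_j)[a_\lambda b]$; $[a_\lambda b]=-(-1)^{\alpha\beta}[b_{-\lambda-\mathbf{T}}a]$; $[a_\lambda[b_\mu c]]=[[a_\lambda b]_{\lambda+\mu}c]+(-1)^{\alpha\beta}[b_\mu[a_\lambda c]]$. An $n$-dim (left) Novikov conformal superalgebra is a $\mathbb{Z}/2\mathbb{Z}$-graded $\mathbb{C}[\mathbf{T}]$-module $R$ with a $\mathbb{C}$-bilinear map $R\otimes R\to R[\lambda]$, $a\otimes b\mapsto a_\lambda b$, such that for all $j$ and $a\in R_\alpha$, $b\in R_\beta$, $c\in R_\gamma$: $(T_ja)_\lambda b=-\lambda_j(a_\lambda b)$, $a_\lambda(T_jb)=(T_j+\lambda_j)(a_\lambda b)$; $(a_\lambda b)_{\lambda+\mu}c-a_\lambda(b_\mu c)=(-1)^{\alpha\beta}\big((b_\mu a)_{\lambda+\mu}c-b_\mu(a_\lambda c)\big)$; $(a_\lambda b)_{\lambda+\mu}c=(-1)^{\beta\gamma}(a_\lambda c)_{-\mu-\mathbf{T}}b$. Substitution convention: if $x_\nu y=\sum_{\mathbf m}\nu^{\mathbf m}z_{\mathbf m}$ with $z_{\mathbf m}\in R$, then $x_{-\lambda-\mathbf{T}}y=\sum_{\mathbf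 m}(-\lambda-\mathbf{T})^{\mathbf m}z_{\mathbf m}$, with $\mathbf{T}$ acting on the $z_{\mathbf m}$; same for brackets. In nested expressions the inner product or bracket is first evaluated (as a polynomial in the parameters with coefficients in $R$), then the outer one is applied, extended linearly over polynomials in the parameters; the outer substitution's $\mathbf{T}$ acts on the final result. An $r$-dim $i$-linear Lie conformal superalgebra is an $r$-dim Lie conformal superalgebra $R=\mathbb{C}[\mathbf{T}]V$, free over a $\mathbb{Z}/2\mathbb{Z}$-graded space $V$, such that for all $a,b\in V$ the bracket has the form $[a_\lambda b]=T_iF+\lambda_iG+H$ with $F,G,H\in\mathbb{C}[\overline{\lambda}_i,\overline{\mathbf{T}}_i]\otimes V$ (depending on $a,b$). The space $\overline{R}_i$ with the two structures satisfying the displayed compatibility condition is called an $(r-1)$-dim super Gel'fand-Dorfman conformal bialgebra. *)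

theory Defs
  imports
    Complex_Main
    "HOL-Library.FuncSet"
    "HOL-Library.Function_Algebras"
    "HOL-Library.Poly_Mapping"
    "HOL-Library.Z2"
begin

section \<open>Polynomials with coefficients in a ring or a module\<close>

type_synonym ('k, 'a) mpoly = "('k \<Rightarrow>\<^sub>0 nat) \<Rightarrow>\<^sub>0 'a"

definition cst :: "'a::zero \<Rightarrow> ('k, 'a) mpoly" where
  "cst a = Poly_Mapping.single 0 a"

definition var :: "'k \<Rightarrow> ('k, 'a::zero_neq_one) mpoly" where
  "var k = Poly_Mapping.single (Poly_Mapping.single k 1) 1"

text \<open>The polynomials in the variables indexed by \<open>I\<close> with coefficients in \<open>A\<close>.\<close>

definition polys :: "'k set \<Rightarrow> 'a::zero set \<Rightarrow> ('k, 'a) mpoly set" where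
  "polys I A = {p. \<forall>m \<in> Poly_Mapping.keys p.
     Poly_Mapping.keys m \<subseteq> I \<and> Poly_Mapping.lookup p m \<in> A}"

text \<open>For an \<open>A\<close>-module \<open>M\<close> with action \<open>act\<close>, the action of \<open>A[X]\<close> on
  \<open>M[X] = A[X] \<otimes>\<^sub>A M\<close>.\<close>

definition pact :: "('a::zero \<Rightarrow> 'm \<Rightarrow> 'm) \<Rightarrow> ('k, 'a) mpoly \<Rightarrow> ('k, 'm::comm_monoid_add) mpoly
    \<Rightarrow> ('k, 'm) mpoly" where
  "pact act q p = (\<Sum>s\<in>Poly_Mapping.keys q. \<Sum>k\<in>Poly_Mapping.keys p.
     Poly_Mapping.single (s + k) (act (Poly_Mapping.lookup q s) (Poly_Mapping.lookup p k)))"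

text \<open>\<open>ctpoly\<close> is \<open>\<complex>[T]\<close>, with one variable for each natural number; the sets \<open>I\<close> below
  select the variables in use, so that \<open>n\<close> variables correspond to \<open>card I = n\<close>.
  \<open>'a par\<close> is the type of polynomials in the two families of parameters \<open>\<lambda>\<close> and \<open>\<mu>\<close>.\<close>

type_synonym ctpoly = "(nat, complex) mpoly"
type_synonym 'a par = "(nat + nat, 'a) mpoly"

definition lam :: "nat \<Rightarrow> ctpoly par" where "lam j = var (Inl j)"
definition mu :: "nat \<Rightarrow> ctpoly par" where "mu j = var (Inr j)"
definition TT :: "nat \<Rightarrow> ctpoly par" where "TT j = cst (var j)"

section \<open>Graded modules\<close>

definition total_space :: "(bit \<Rightarrow> 'm::ab_group_add set) \<Rightarrow> 'm set" where
  "total_space M = {x + y | x y. x \<in> M 0 \<and> y \<in> M 1}"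

text \<open>The ambient type is a module over the whole ring, but the graded pieces \<open>M 0\<close> and \<open>M 1\<close>
  need only be stable under the scalars in the subring \<open>S\<close>; their direct sum \<open>total_space M\<close> is the
  graded \<open>S\<close>-module under consideration. For \<open>S\<close> the polynomials in the variables \<open>I\<close>, this is no
  restriction, since the other variables may be taken to act as \<open>0\<close>.\<close>

definition graded_module :: "'a::comm_ring_1 set \<Rightarrow> ('a \<Rightarrow> 'm::ab_group_add \<Rightarrow> 'm)
    \<Rightarrow> (bit \<Rightarrow> 'm set) \<Rightarrow> bool" where
  "graded_module S act M \<longleftrightarrow>
     module act \<and>
     (\<forall>\<alpha>. 0 \<in> M \<alpha> \<and> (\<forall>x\<in>M \<alpha>. \<forall>y\<in>M \<alpha>. x + y \<in> M \<alpha>) \<and> (\<forall>p\<in>S. \<forall>x\<in>M \<alpha>. act p x \<in> M \<alpha>)) \<and>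
     M 0 \<inter> M 1 = {0}"

text \<open>The sign \<open>(-1)^(\<alpha>\<beta>)\<close>.\<close>

definition ksign :: "bit \<Rightarrow> bit \<Rightarrow> ctpoly par" where
  "ksign \<alpha> \<beta> = (if \<alpha> * \<beta> = 1 then - 1 else 1)"

section \<open>Products depending on parameters\<close>

text \<open>A product \<open>B\<close> with values in \<open>R[\<nu>]\<close> is a function into \<open>(nat, 'm) mpoly\<close>.
  \<open>psubst act X p\<close> replaces \<open>\<nu>\<^sub>j\<close> in \<open>p\<close> by the polynomial \<open>X j\<close> in \<open>\<lambda>, \<mu>, T\<close>, where \<open>T\<close> acts on
  the coefficients; only those \<open>X j\<close> matter for which \<open>\<nu>\<^sub>j\<close> occurs in \<open>p\<close>.
  \<open>cprod act B P X Q\<close> is \<open>P\<close> times \<open>Q\<close> with index \<open>X\<close>, for \<open>P\<close> and \<open>Q\<close> in \<open>R[\<lambda>, \<mu>]\<close>: the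
  product is extended linearly over the parameters occurring in its arguments, and \<open>X\<close> is
  substituted in the resulting value.\<close>

definition psubst :: "(ctpoly \<Rightarrow> 'm \<Rightarrow> 'm) \<Rightarrow> (nat \<Rightarrow> ctpoly par) \<Rightarrow> (nat, 'm::ab_group_add) mpoly
    \<Rightarrow> 'm par" where
  "psubst act X p = (\<Sum>m\<in>Poly_Mapping.keys p.
     pact act (\<Prod>j\<in>Poly_Mapping.keys m. X j ^ Poly_Mapping.lookup m j)
       (cst (Poly_Mapping.lookup p m)))"

definition cprod :: "(ctpoly \<Rightarrow> 'm \<Rightarrow> 'm) \<Rightarrow> ('m \<Rightarrow> 'm \<Rightarrow> (nat, 'm) mpoly) \<Rightarrow>
    'm par \<Rightarrow> (nat \<Rightarrow> ctpoly par) \<Rightarrow> 'm par \<Rightarrow> 'm::ab_group_add par" where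
  "cprod act B P X Q = (\<Sum>k\<in>Poly_Mapping.keys P. \<Sum>l\<in>Poly_Mapping.keys Q.
     pact act (Poly_Mapping.single (k + l) 1)
       (psubst act X (B (Poly_Mapping.lookup P k) (Poly_Mapping.lookup Q l))))"

text \<open>What the two kinds of conformal superalgebras have in common. Products are
  extensional functions on the carrier, so that equality of structures is equality of functions.\<close>

definition conformal_product :: "nat set \<Rightarrow> (ctpoly \<Rightarrow> 'm \<Rightarrow> 'm) \<Rightarrow> (bit \<Rightarrow> 'm::ab_group_add set)
    \<Rightarrow> ('m \<Rightarrow> 'm \<Rightarrow> (nat, 'm) mpoly) \<Rightarrow> bool" where
  "conformal_product I act M B \<longleftrightarrow>
     graded_module (polys I UNIV) act M \<and>
     B \<in> total_space M \<rightarrow>\<^sub>E total_space M \<rightarrow>\<^sub>E polys I (total_space M) \<and>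
     (\<forall>\<alpha> \<beta>. \<forall>a\<in>M \<alpha>. \<forall>b\<in>M \<beta>. B a b \<in> polys I (M (\<alpha> + \<beta>))) \<and>
     (\<forall>a\<in>total_space M. \<forall>a'\<in>total_space M. \<forall>b\<in>total_space M.
        B (a + a') b = B a b + B a' b \<and> B b (a + a') = B b a + B b a') \<and>
     (\<forall>z. \<forall>a\<in>total_space M. \<forall>b\<in>total_space M.
        B (act (cst z) a) b = pact act (cst (cst z)) (B a b) \<and>
        B a (act (cst z) b) = pact act (cst (cst z)) (B a b)) \<and>
     (\<forall>j\<in>I. \<forall>a\<in>total_space M. \<forall>b\<in>total_space M.
        cprod act B (cst (act (var j) a)) lam (cst b) =
          pact act (- lam j) (cprod act B (cst a) lam (cst b)) \<and>
        cprod act B (cst a) lam (cst (act (var j) b)) =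
          pact act (TT j + lam j) (cprod act B (cst a) lam (cst b)))"

definition lie_conformal_superalgebra :: "nat set \<Rightarrow> (ctpoly \<Rightarrow> 'm \<Rightarrow> 'm) \<Rightarrow>
    (bit \<Rightarrow> 'm::ab_group_add set) \<Rightarrow> ('m \<Rightarrow> 'm \<Rightarrow> (nat, 'm) mpoly) \<Rightarrow> bool" where
  "lie_conformal_superalgebra I act M B \<longleftrightarrow>
     conformal_product I act M B \<and>
     (\<forall>\<alpha> \<beta>. \<forall>a\<in>M \<alpha>. \<forall>b\<in>M \<beta>.
        cprod act B (cst a) lam (cst b) =
          - pact act (ksign \<alpha> \<beta>) (cprod act B (cst b) (- lam - TT) (cst a))) \<and>
     (\<forall>\<alpha> \<beta>. \<forall>a\<in>M \<alpha>. \<forall>b\<in>M \<beta>. \<forall>c\<in>total_space M.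
        cprod act B (cst a) lam (cprod act B (cst b) mu (cst c)) =
          cprod act B (cprod act B (cst a) lam (cst b)) (lam + mu) (cst c) +
          pact act (ksign \<alpha> \<beta>) (cprod act B (cst b) mu (cprod act B (cst a) lam (cst c))))"

definition novikov_conformal_superalgebra :: "nat set \<Rightarrow> (ctpoly \<Rightarrow> 'm \<Rightarrow> 'm) \<Rightarrow>
    (bit \<Rightarrow> 'm::ab_group_add set) \<Rightarrow> ('m \<Rightarrow> 'm \<Rightarrow> (nat, 'm) mpoly) \<Rightarrow> bool" where
  "novikov_conformal_superalgebra I act M B \<longleftrightarrow>
     conformal_product I act M B \<and>
     (\<forall>\<alpha> \<beta> \<gamma>. \<forall>a\<in>M \<alpha>. \<forall>b\<in>M \<beta>. \<forall>c\<in>M \<gamma>.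
        cprod act B (cprod act B (cst a) lam (cst b)) (lam + mu) (cst c) -
          cprod act B (cst a) lam (cprod act B (cst b) mu (cst c)) =
        pact act (ksign \<alpha> \<beta>)
          (cprod act B (cprod act B (cst b) mu (cst a)) (lam + mu) (cst c) -
           cprod act B (cst b) mu (cprod act B (cst a) lam (cst c)))) \<and>
     (\<forall>\<alpha> \<beta> \<gamma>. \<forall>a\<in>M \<alpha>. \<forall>b\<in>M \<beta>. \<forall>c\<in>M \<gamma>.
        cprod act B (cprod act B (cst a) lam (cst b)) (lam + mu) (cst c) =
        pact act (ksign \<beta> \<gamma>)
          (cprod act B (cprod act B (cst a) lam (cst c)) (- mu - TT) (cst b)))"

section \<open>Structures on free modules\<close>

text \<open>The free module over \<open>V\<close> in the variables indexed by \<open>I\<close> has the graded pieces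
  \<open>free_pieces I V\<close> and the action \<open>pact scale\<close>; \<open>V\<close> is embedded by \<open>cst\<close>.\<close>

definition free_pieces :: "nat set \<Rightarrow> (bit \<Rightarrow> 'v::ab_group_add set) \<Rightarrow> bit \<Rightarrow> (nat, 'v) mpoly set" where
  "free_pieces I V \<alpha> = polys I (V \<alpha>)"

text \<open>The elements \<open>F\<close>, \<open>G\<close>, \<open>H\<close> are polynomials in the remaining parameters, with coefficients
  that are polynomials in the remaining \<open>T\<close>.\<close>

definition linear_lie_structures :: "nat set \<Rightarrow> nat \<Rightarrow> (complex \<Rightarrow> 'v \<Rightarrow> 'v) \<Rightarrow>
    (bit \<Rightarrow> 'v::ab_group_add set) \<Rightarrow> ((nat, 'v) mpoly \<Rightarrow> (nat, 'v) mpoly \<Rightarrow> (nat, (nat, 'v) mpoly) mpoly) set"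
  where
  "linear_lie_structures I i scale V = {L.
     lie_conformal_superalgebra I (pact scale) (free_pieces I V) L \<and>
     (\<forall>a\<in>total_space V. \<forall>b\<in>total_space V.
        \<exists>F \<in> polys (I - {i}) (polys (I - {i}) (total_space V)).
        \<exists>G \<in> polys (I - {i}) (polys (I - {i}) (total_space V)).
        \<exists>H \<in> polys (I - {i}) (polys (I - {i}) (total_space V)).
          cprod (pact scale) L (cst (cst a)) lam (cst (cst b)) =
            pact (pact scale) (TT i) (psubst (pact scale) lam F) +
            pact (pact scale) (lam i) (psubst (pact scale) lam G) +
            psubst (pact scale) lam H)}"

text \<open>The compatibility condition between a product \<open>N\<close> and a bracket \<open>K\<close>.\<close>

definition gelfand_dorfman_compatible :: "(complex \<Rightarrow> 'v \<Rightarrow> 'v) \<Rightarrow> (bit \<Rightarrow> 'v::ab_group_add set) \<Rightarrow>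
    ((nat, 'v) mpoly \<Rightarrow> (nat, 'v) mpoly \<Rightarrow> (nat, (nat, 'v) mpoly) mpoly) \<Rightarrow>
    ((nat, 'v) mpoly \<Rightarrow> (nat, 'v) mpoly \<Rightarrow> (nat, (nat, 'v) mpoly) mpoly) \<Rightarrow> bool" where
  "gelfand_dorfman_compatible scale V N K \<longleftrightarrow>
     (\<forall>\<beta> \<gamma>. \<forall>a'\<in>total_space V. \<forall>b'\<in>V \<beta>. \<forall>c'\<in>V \<gamma>.
       (let act = pact scale; a = cst (cst a'); b = cst (cst b'); c = cst (cst c') in
          cprod act K (cprod act N a (- mu - TT) b) (- lam - TT) c
        + cprod act N (cprod act K a (- mu - TT) b) (- lam - TT) c
        - cprod act N a (- lam - mu - TT) (cprod act K b (- lam - TT) c)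
        - pact act (ksign \<beta> \<gamma>) (cprod act K (cprod act N a (- lam - TT) c) (- mu - TT) b)
        - pact act (ksign \<beta> \<gamma>) (cprod act N (cprod act K a (- lam - TT) c) (- mu - TT) b)
        = 0))"

definition super_gelfand_dorfman_structures :: "nat set \<Rightarrow> (complex \<Rightarrow> 'v \<Rightarrow> 'v) \<Rightarrow>
    (bit \<Rightarrow> 'v::ab_group_add set) \<Rightarrow>
    (((nat, 'v) mpoly \<Rightarrow> (nat, 'v) mpoly \<Rightarrow> (nat, (nat, 'v) mpoly) mpoly) \<times>
     ((nat, 'v) mpoly \<Rightarrow> (nat, 'v) mpoly \<Rightarrow> (nat, (nat, 'v) mpoly) mpoly)) set" where
  "super_gelfand_dorfman_structures J scale V = {(N, K).
     novikov_conformal_superalgebra J (pact scale) (free_pieces J V) N \<and>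
     lie_conformal_superalgebra J (pact scale) (free_pieces J V) K \<and>
     gelfand_dorfman_compatible scale V N K}"

text \<open>The formula expressing the bracket \<open>L\<close> on generators through \<open>N\<close> and \<open>K\<close>. As \<open>N\<close> and \<open>K\<close> take
  polynomial values in the parameters other than the \<open>i\<close>-th, substituting the full tuples
  \<open>lam\<close> and \<open>- lam - TT\<close> in them involves only the entries other than the \<open>i\<close>-th.\<close>

definition bracket_formula :: "nat \<Rightarrow> (complex \<Rightarrow> 'v \<Rightarrow> 'v) \<Rightarrow> (bit \<Rightarrow> 'v::ab_group_add set) \<Rightarrow>
    ((nat, 'v) mpoly \<Rightarrow> (nat, 'v) mpoly \<Rightarrow> (nat, (nat, 'v) mpoly) mpoly) \<Rightarrow>
    ((nat, 'v) mpoly \<Rightarrow> (nat, 'v) mpoly \<Rightarrow> (nat, (nat, 'v) mpoly) mpoly) \<Rightarrow>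
    ((nat, 'v) mpoly \<Rightarrow> (nat, 'v) mpoly \<Rightarrow> (nat, (nat, 'v) mpoly) mpoly) \<Rightarrow> bool" where
  "bracket_formula i scale V N K L \<longleftrightarrow>
     (\<forall>\<alpha> \<beta>. \<forall>a'\<in>V \<alpha>. \<forall>b'\<in>V \<beta>.
       (let act = pact scale; a = cst (cst a'); b = cst (cst b') in
          cprod act L a lam b =
            pact act (TT i) (pact act (ksign \<alpha> \<beta>) (cprod act N b (- lam - TT) a))
          + pact act (lam i)
              (pact act (ksign \<alpha> \<beta>) (cprod act N b (- lam - TT) a) + cprod act N a lam b)
          + cprod act K a lam b))"

end

theory Submission
  imports Defs
begin

text \<open>
  The bracket formula is the affinization construction of Gel'fand and Dorfman, and this becomes visible
  once all polynomials are evaluated. As \<open>\<complex>\<close> is infinite, a polynomial with coefficients in \<open>V\<close> is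
  determined by its values (\<open>monom_at_independent_mod\<close>), so a conformal product on the free module
  is determined by the values in \<open>V\<close> of \<open>a\<^sub>\<lambda> b\<close>, for \<open>a, b \<in> V\<close>, at \<open>\<lambda> = p\<close> and \<open>T = - p - q\<close>. Write these as
  \<open>f a b p q\<close> and think of \<open>p\<close> and \<open>q\<close> as the momenta carried by \<open>a\<close> and \<open>b\<close>; the product then carries the
  momentum \<open>p + q = - T\<close>. By sesquilinearity an arbitrary module element enters a product only through
  its value at \<open>T\<close> equal to minus its momentum. Hence conformal products correspond exactly to
  the families \<open>f\<close> of even bilinear maps that are polynomial in \<open>p\<close> and \<open>q\<close>
  (\<open>conformal_product_kernel\<close>, \<open>conformal_product_of\<close>), and each substitution of \<open>- \<lambda> - T\<close> only
  renames momenta. All the axioms turn into the axioms of ordinary Lie or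
  Novikov superalgebras, with a momentum attached to each element (\<open>lie_iff\<close>, \<open>novikov_iff\<close>,
  \<open>compatible_iff\<close>).

  In these terms the bracket formula reads
  \<open>[a b] = p\<^sub>i (a \<circ> b) - (-1)^(\<alpha>\<beta>) q\<^sub>i (b \<circ> a) + [a b]\<^sub>K\<close>,
  where neither \<open>\<circ>\<close> nor \<open>[ ]\<^sub>K\<close> depends on the \<open>i\<close>-th coordinates of the momenta. It is skew if and only if
  \<open>[ ]\<^sub>K\<close> is. Its Jacobi identity is a quadratic polynomial in the three independent numbers
  \<open>p\<^sub>i, q\<^sub>i, r\<^sub>i\<close> (\<open>jacobi_defect_gd_bracket\<close>): the coefficients of the squares express
  right commutativity of \<open>\<circ>\<close>, those of the mixed products left symmetry, the linear ones the
  compatibility condition, and the constant one the Jacobi identity of \<open>[ ]\<^sub>K\<close>. Comparing coefficients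
  shows that the formula maps the structures on the smaller module to Lie structures on the
  larger one. Conversely, an \<open>i\<close>-linear bracket has, in terms of momenta, the form
  \<open>p\<^sub>i f + q\<^sub>i h + g\<close> with \<open>f, g, h\<close> free of \<open>p\<^sub>i\<close> and \<open>q\<^sub>i\<close>, and skew symmetry forces \<open>h a b\<close> to be minus the signed
  opposite of \<open>f\<close> (\<open>gd_bracket_of_linear_kernel\<close>), so the map is onto. It is injective because \<open>f\<close> and \<open>g\<close>
  can be read off at \<open>p\<^sub>i \<in> {0, 1}\<close> and \<open>q\<^sub>i = 0\<close>.
\<close>

section \<open>Evaluation of polynomials\<close>

definition monom_at :: "('k \<Rightarrow> complex) \<Rightarrow> ('k \<Rightarrow>\<^sub>0 nat) \<Rightarrow> complex" where
  "monom_at y m = (\<Prod>j\<in>Poly_Mapping.keys m. y j ^ Poly_Mapping.lookup m j)"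

lemma monom_at_superset:
  assumes "finite S" "Poly_Mapping.keys m \<subseteq> S"
  shows "monom_at y m = (\<Prod>j\<in>S. y j ^ Poly_Mapping.lookup m j)"
  unfolding monom_at_def using assms
  by (intro prod.mono_neutral_left) (auto simp: in_keys_iff)

lemma monom_at_0 [simp]: "monom_at y 0 = 1"
  by (simp add: monom_at_def)

lemma monom_at_single [simp]: "monom_at y (Poly_Mapping.single j n) = y j ^ n"
  by (cases "n = 0") (auto simp: monom_at_def)

lemma monom_at_add: "monom_at y (m + n) = monom_at y m * monom_at y n"
proof -
  let ?S = "Poly_Mapping.keys m \<union> Poly_Mapping.keys n"
  have "monom_at y (m + n) = (\<Prod>j\<in>?S. y j ^ Poly_Mapping.lookup (m + n) j)"
    by (rule monom_at_superset) (use keys_add[of m n] in auto)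
  also have "\<dots> = (\<Prod>j\<in>?S. y j ^ Poly_Mapping.lookup m j) * (\<Prod>j\<in>?S. y j ^ Poly_Mapping.lookup n j)"
    by (simp add: lookup_add power_add prod.distrib)
  finally show ?thesis
    by (simp add: monom_at_superset[where S = ?S])
qed

lemma monom_at_mult: "monom_at (\<lambda>j. y j * z j) m = monom_at y m * monom_at z m"
  by (simp add: monom_at_def power_mult_distrib prod.distrib)

lemma monom_at_cong: "(\<And>j. j \<in> Poly_Mapping.keys m \<Longrightarrow> y j = z j) \<Longrightarrow> monom_at y m = monom_at z m"
  by (simp add: monom_at_def)

text \<open>Two distinct exponents differ in some entry \<open>j\<close>, and the point with entry \<open>2\<close> at \<open>j\<close> and
  \<open>1\<close> elsewhere tells the two monomials apart.\<close>

lemma monom_at_separates: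
  assumes "m \<noteq> n"
  obtains y where "monom_at y m \<noteq> monom_at y n"
proof -
  obtain j where j: "Poly_Mapping.lookup m j \<noteq> Poly_Mapping.lookup n j"
    using assms by (auto simp: poly_mapping_eq_iff fun_eq_iff)
  have *: "monom_at (\<lambda>k. if k = j then 2 else 1) m = 2 ^ Poly_Mapping.lookup m j" for m
  proof -
    have "monom_at (\<lambda>k. if k = j then 2 else 1) m
        = (\<Prod>k\<in>insert j (Poly_Mapping.keys m). (if k = j then 2 else 1) ^ Poly_Mapping.lookup m k)"
      by (rule monom_at_superset) auto
    also have "\<dots> = (\<Prod>k\<in>insert j (Poly_Mapping.keys m). if k = j then 2 ^ Poly_Mapping.lookup m j else 1)"
      by (rule prod.cong) auto
    also have "\<dots> = 2 ^ Poly_Mapping.lookup m j"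
      by (simp only: prod.delta finite.insertI finite_keys insertI1 if_True)
    finally show ?thesis .
  qed
  have "(2::complex) ^ Poly_Mapping.lookup m j \<noteq> 2 ^ Poly_Mapping.lookup n j"
  proof
    assume "(2::complex) ^ Poly_Mapping.lookup m j = 2 ^ Poly_Mapping.lookup n j"
    then have "(of_nat (2 ^ Poly_Mapping.lookup m j) :: complex) = of_nat (2 ^ Poly_Mapping.lookup n j)"
      by simp
    then have "(2::nat) ^ Poly_Mapping.lookup m j = 2 ^ Poly_Mapping.lookup n j"
      by (rule of_nat_eq_iff[THEN iffD1])
    then show False using j by simp
  qed
  then show thesis using that[of "\<lambda>k. if k = j then 2 else 1"] unfolding * by blast
qed

locale complex_space = vector_space scale
  for scale :: "complex \<Rightarrow> 'v::ab_group_add \<Rightarrow> 'v"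
begin

text \<open>The coefficients are first mapped into the vector space by \<open>\<phi>\<close>. With \<open>\<phi>\<close> itself an evaluation,
  this evaluates polynomials whose coefficients are polynomials.\<close>

definition peval :: "('a \<Rightarrow> 'v) \<Rightarrow> ('k \<Rightarrow> complex) \<Rightarrow> ('k, 'a::zero) mpoly \<Rightarrow> 'v" where
  "peval \<phi> y p = (\<Sum>m\<in>Poly_Mapping.keys p. scale (monom_at y m) (\<phi> (Poly_Mapping.lookup p m)))"

lemma peval_superset:
  assumes "\<phi> 0 = 0" "finite S" "Poly_Mapping.keys p \<subseteq> S"
  shows "peval \<phi> y p = (\<Sum>m\<in>S. scale (monom_at y m) (\<phi> (Poly_Mapping.lookup p m)))"
  unfolding peval_def using assms
  by (intro sum.mono_neutral_left) (auto simp: in_keys_iff)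

lemma peval_single: "\<phi> 0 = 0 \<Longrightarrow> peval \<phi> y (Poly_Mapping.single m a) = scale (monom_at y m) (\<phi> a)"
  by (subst peval_superset[where S = "{m}"]) auto

lemma peval_cst: "\<phi> 0 = 0 \<Longrightarrow> peval \<phi> y (cst a) = \<phi> a"
  by (simp add: cst_def peval_single)

lemma additive_peval:
  assumes "additive \<phi>"
  shows "additive (peval \<phi> y)"
proof
  fix p q :: "('b, 'a) mpoly"
  interpret additive \<phi> by fact
  let ?S = "Poly_Mapping.keys p \<union> Poly_Mapping.keys q"
  have "peval \<phi> y (p + q) = (\<Sum>m\<in>?S. scale (monom_at y m) (\<phi> (Poly_Mapping.lookup (p + q) m)))"
    by (rule peval_superset) (use keys_add[of p q] in \<open>auto simp: zero\<close>)
  then show "peval \<phi> y (p + q) = peval \<phi> y p + peval \<phi> y q"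
    by (simp add: peval_superset[where S = ?S] zero lookup_add add scale_right_distrib sum.distrib)
qed

text \<open>The monomials are pairwise distinct characters of the multiplicative monoid of points, so
  Dedekind's argument shows their independence, with coefficients taken modulo any subspace \<open>W\<close>.\<close>

lemma monom_at_independent_mod:
  fixes u :: "('k \<Rightarrow>\<^sub>0 nat) \<Rightarrow> 'v"
  assumes W: "subspace W" and "finite K"
    and "\<And>y. (\<Sum>m\<in>K. scale (monom_at y m) (u m)) \<in> W" and "m \<in> K"
  shows "u m \<in> W"
  using assms(2-)
proof (induction "card K" arbitrary: K u m rule: less_induct)
  case less
  have *: "u m' \<in> W" if m': "m' \<in> K" "m' \<noteq> m" for m'
  proof -
    obtain z where z: "monom_at z m' \<noteq> monom_at z m"
      using monom_at_separates[OF m'(2)] by blast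
    (* Multiplying the point by z and subtracting monom_at z m times the relation removes
       the term for m and keeps the one for m'. *)
    have "(\<Sum>n\<in>K - {m}. scale (monom_at y n) (scale (monom_at z n - monom_at z m) (u n))) \<in> W" for y
    proof -
      have "(\<Sum>n\<in>K. scale (monom_at (\<lambda>j. y j * z j) n) (u n))
          - scale (monom_at z m) (\<Sum>n\<in>K. scale (monom_at y n) (u n)) \<in> W"
        using W less.prems by (intro subspace_diff subspace_scale)
      also have "(\<Sum>n\<in>K. scale (monom_at (\<lambda>j. y j * z j) n) (u n))
          - scale (monom_at z m) (\<Sum>n\<in>K. scale (monom_at y n) (u n))
          = (\<Sum>n\<in>K. scale (monom_at y n) (scale (monom_at z n - monom_at z m) (u n)))"
        by (simp add: monom_at_mult scale_sum_right sum_subtractf[symmetric]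
            scale_left_diff_distrib[symmetric] algebra_simps del: scale_left_diff_distrib)
      also have "\<dots> = (\<Sum>n\<in>K - {m}. scale (monom_at y n) (scale (monom_at z n - monom_at z m) (u n)))"
        using less.prems by (intro sum.mono_neutral_right) auto
      finally show ?thesis .
    qed
    then have "scale (monom_at z m' - monom_at z m) (u m') \<in> W"
      using less.prems m'
      by (intro less.hyps[of "K - {m}" "\<lambda>n. scale (monom_at z n - monom_at z m) (u n)" m'])
        (auto simp del: card_Diff_insert card_Diff_singleton intro: card_Diff1_less)
    from subspace_scale[OF W this, of "inverse (monom_at z m' - monom_at z m)"] z
    show ?thesis by simp
  qed
  (* With all other coefficients in W, so is the one at m: evaluate at the point 1. *)
  have "(\<Sum>n\<in>K. u n) \<in> W"
    using less.prems(2)[of "\<lambda>_. 1"] by (simp add: monom_at_def)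
  then have "u m + (\<Sum>n\<in>K - {m}. u n) \<in> W"
    using less.prems by (simp add: sum.remove)
  moreover have "(\<Sum>n\<in>K - {m}. u n) \<in> W"
    using * by (intro subspace_sum[OF W]) auto
  ultimately show ?case
    using subspace_diff[OF W] by fastforce
qed

lemma peval_coeff_in:
  assumes "subspace W" "\<phi> 0 = 0" "\<And>y. peval \<phi> y p \<in> W"
  shows "\<phi> (Poly_Mapping.lookup p m) \<in> W"
proof (cases "m \<in> Poly_Mapping.keys p")
  case True
  then show ?thesis
    using assms monom_at_independent_mod[of W "Poly_Mapping.keys p" "\<lambda>m. \<phi> (Poly_Mapping.lookup p m)" m]
    by (simp add: peval_def)
next
  case False
  then show ?thesis using assms by (simp add: in_keys_iff subspace_0)
qed

lemma peval_coeff_eq: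
  assumes "\<phi> 0 = 0" "\<psi> 0 = 0" "\<And>y. peval \<phi> y p = peval \<psi> y q"
  shows "\<phi> (Poly_Mapping.lookup p m) = \<psi> (Poly_Mapping.lookup q m)"
proof -
  let ?S = "insert m (Poly_Mapping.keys p \<union> Poly_Mapping.keys q)"
  have "(\<Sum>m\<in>?S. scale (monom_at y m) (\<phi> (Poly_Mapping.lookup p m) - \<psi> (Poly_Mapping.lookup q m))) \<in> {0}" for y
    using assms(3)[of y] assms(1,2)
    by (simp only: peval_superset[where S = ?S] scale_right_diff_distrib sum_subtractf) 
       (simp add: peval_superset[where S = ?S] subset_insertI2)
  from monom_at_independent_mod[OF subspace_single_0 _ this, of m] show ?thesis by simp
qed

text \<open>A monomial that involves a variable outside \<open>I\<close> is killed by setting those variables to \<open>0\<close>.\<close>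

lemma peval_keys_subset:
  assumes "\<phi> 0 = 0" "\<And>y z. (\<And>j. j \<in> I \<Longrightarrow> y j = z j) \<Longrightarrow> peval \<phi> y p = peval \<phi> z p"
    and "\<phi> (Poly_Mapping.lookup p m) \<noteq> 0"
  shows "Poly_Mapping.keys m \<subseteq> I"
proof (rule ccontr)
  assume m: "\<not> Poly_Mapping.keys m \<subseteq> I"
  let ?S = "{m \<in> Poly_Mapping.keys p. Poly_Mapping.keys m \<subseteq> I}"
  let ?u = "\<lambda>m. if Poly_Mapping.keys m \<subseteq> I then 0 else \<phi> (Poly_Mapping.lookup p m)"
  have "(\<Sum>m\<in>Poly_Mapping.keys p. scale (monom_at y m) (?u m)) \<in> {0}" for y
  proof -
    let ?z = "\<lambda>j. if j \<in> I then y j else 0"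
    have z: "monom_at ?z n = (if Poly_Mapping.keys n \<subseteq> I then monom_at y n else 0)" for n
    proof (cases "Poly_Mapping.keys n \<subseteq> I")
      case True
      then show ?thesis by (auto intro!: monom_at_cong)
    next
      case False
      then obtain j where "j \<in> Poly_Mapping.keys n" "j \<notin> I" by blast
      then have "monom_at ?z n = 0"
        unfolding monom_at_def by (intro prod_zero) (auto simp: in_keys_iff intro!: bexI[of _ j])
      then show ?thesis using False by simp
    qed
    have "peval \<phi> ?z p = peval \<phi> y p"
      by (rule assms(2)) simp
    then have "(\<Sum>m\<in>Poly_Mapping.keys p. scale (monom_at y m) (\<phi> (Poly_Mapping.lookup p m))
        - scale (monom_at ?z m) (\<phi> (Poly_Mapping.lookup p m))) = 0"
      by (simp add: peval_def sum_subtractf)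
    also have "(\<Sum>m\<in>Poly_Mapping.keys p. scale (monom_at y m) (\<phi> (Poly_Mapping.lookup p m))
        - scale (monom_at ?z m) (\<phi> (Poly_Mapping.lookup p m)))
        = (\<Sum>m\<in>Poly_Mapping.keys p. scale (monom_at y m) (?u m))"
      by (rule sum.cong) (auto simp: z)
    finally show ?thesis by simp
  qed
  from monom_at_independent_mod[OF subspace_single_0 _ this, of m] m assms(1,3) show False
    by (cases "m \<in> Poly_Mapping.keys p") (simp_all add: in_keys_iff)
qed

lemma peval_cong_on:
  assumes "\<And>m. m \<in> Poly_Mapping.keys p \<Longrightarrow> Poly_Mapping.keys m \<subseteq> I"
    and "\<And>j. j \<in> I \<Longrightarrow> y j = z j"
  shows "peval \<phi> y p = peval \<phi> z p"
  unfolding peval_def using assms by (intro sum.cong arg_cong2[where f = scale] monom_at_cong) auto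

end

interpretation cplx: complex_space "(*) :: complex \<Rightarrow> complex \<Rightarrow> complex"
  by unfold_locales (auto simp: algebra_simps)

(* As a simplification rule, this associativity law would run in circles with mult_ac. *)
declare cplx.scale_scale [simp del]

context complex_space begin

text \<open>Evaluation turns the action of polynomials into the action of scalars.\<close>

lemma peval_pact:
  assumes \<phi>: "additive \<phi>" and \<psi>: "\<psi> 0 = 0" and act: "\<And>c x. \<phi> (act c x) = scale (\<psi> c) (\<phi> x)"
  shows "peval \<phi> y (pact act q p) = scale (cplx.peval \<psi> y q) (peval \<phi> y p)"
proof -
  interpret \<phi>: additive \<phi> by fact
  interpret p: additive "peval \<phi> y" by (rule additive_peval) fact
  show ?thesis
    unfolding pact_def p.sum peval_def[of \<phi> y p] cplx.peval_def[of \<psi> y q] scale_sum_left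
    unfolding scale_sum_right
    by (simp add: peval_single \<phi>.zero act monom_at_add mult_ac)
qed

end

lemma poly_mapping_sum_single:
  "p = (\<Sum>k\<in>Poly_Mapping.keys p. Poly_Mapping.single k (Poly_Mapping.lookup p k))"
  by (rule poly_mapping_eqI)
    (simp add: lookup_sum lookup_single when_def in_keys_iff)

lemma times_eq_pact: "p * q = pact (*) p q" for p q :: "('k, 'a::comm_ring_1) mpoly"
proof -
  have "p * q = (\<Sum>k\<in>Poly_Mapping.keys p. Poly_Mapping.single k (Poly_Mapping.lookup p k)) *
     (\<Sum>k\<in>Poly_Mapping.keys q. Poly_Mapping.single k (Poly_Mapping.lookup q k))"
    by (simp flip: poly_mapping_sum_single)
  then show ?thesis
    by (simp add: pact_def sum_product mult_single)
qed

lemma cplx_peval_mult: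
  fixes p q :: "('k, 'a::comm_ring_1) mpoly"
  assumes "additive \<psi>" "\<And>a b. \<psi> (a * b) = \<psi> a * \<psi> b"
  shows "cplx.peval \<psi> y (p * q) = cplx.peval \<psi> y p * cplx.peval \<psi> y q"
  unfolding times_eq_pact
  by (rule cplx.peval_pact) (use assms additive.zero in auto)

section \<open>Values of the polynomials in play\<close>

definition cval :: "('k \<Rightarrow> complex) \<Rightarrow> ('k, complex) mpoly \<Rightarrow> complex" where
  "cval t = cplx.peval (\<lambda>z. z) t"

definition cval2 :: "('l \<Rightarrow> complex) \<Rightarrow> ('k \<Rightarrow> complex) \<Rightarrow> ('l, ('k, complex) mpoly) mpoly \<Rightarrow> complex" where
  "cval2 y t = cplx.peval (cval t) y"

lemma additive_cval: "additive (cval t)"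
  unfolding cval_def by (rule cplx.additive_peval) (standard, simp)

lemma additive_cval2: "additive (cval2 y t)"
  unfolding cval2_def by (rule cplx.additive_peval) (rule additive_cval)

lemmas cval_simps [simp] =
  additive.zero[OF additive_cval] additive.add[OF additive_cval] additive.minus[OF additive_cval]
  additive.diff[OF additive_cval]
  additive.zero[OF additive_cval2] additive.add[OF additive_cval2] additive.minus[OF additive_cval2]
  additive.diff[OF additive_cval2]

lemma cval_cst [simp]: "cval t (cst z) = z"
  by (simp add: cval_def cplx.peval_cst)

lemma cval2_cst [simp]: "cval2 y t (cst q) = cval t q"
  by (simp add: cval2_def cplx.peval_cst)

lemma cval_var [simp]: "cval t (var j) = t j"
  by (simp add: cval_def var_def cplx.peval_single)

lemma cst_1: "cst 1 = 1"
  by (simp add: cst_def)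

lemma cval_1 [simp]: "cval t 1 = 1"
  using cval_cst[of t 1] by (simp add: cst_1)

lemma cval2_1 [simp]: "cval2 y t 1 = 1"
  using cval2_cst[of y t 1] by (simp add: cst_1)

lemma cval_mult [simp]: "cval t (p * q) = cval t p * cval t q"
  unfolding cval_def by (rule cplx_peval_mult) (simp_all add: additive_def)

lemma cval2_mult [simp]: "cval2 y t (p * q) = cval2 y t p * cval2 y t q"
  unfolding cval2_def by (rule cplx_peval_mult) (rule additive_cval, simp)

lemma cval2_power [simp]: "cval2 y t (p ^ n) = cval2 y t p ^ n"
  by (induction n) simp_all

lemma cval2_prod [simp]: "cval2 y t (prod f A) = (\<Prod>x\<in>A. cval2 y t (f x))"
  by (induction A rule: infinite_finite_induct) simp_all

lemma cval2_single_1 [simp]: "cval2 y t (Poly_Mapping.single m 1) = monom_at y m"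
  by (simp add: cval2_def cplx.peval_single)

lemma cval2_parameters [simp]:
  "cval2 y t (lam j) = y (Inl j)" "cval2 y t (mu j) = y (Inr j)" "cval2 y t (TT j) = t j"
  by (simp_all add: lam_def mu_def TT_def) (simp_all add: var_def)

definition pt :: "('l \<Rightarrow> complex) \<Rightarrow> ('k \<Rightarrow> complex) \<Rightarrow> (nat \<Rightarrow> ('l, ('k, complex) mpoly) mpoly) \<Rightarrow> nat \<Rightarrow> complex" where
  "pt y t X = (\<lambda>j. cval2 y t (X j))"

declare case_sum_o_inj [simp]

lemma pt_simps [simp]:
  "pt y t lam = y \<circ> Inl" "pt y t mu = y \<circ> Inr" "pt y t TT = t"
  "pt y t (X + Y) = pt y t X + pt y t Y" "pt y t (X - Y) = pt y t X - pt y t Y" "pt y t (- X) = - pt y t X"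
  by (auto simp: pt_def fun_eq_iff)

definition sg :: "bit \<Rightarrow> bit \<Rightarrow> complex" where
  "sg \<alpha> \<beta> = (if \<alpha> * \<beta> = 1 then - 1 else 1)"

lemma cval2_ksign [simp]: "cval2 y t (ksign \<alpha> \<beta>) = sg \<alpha> \<beta>"
  by (simp add: ksign_def sg_def)

context complex_space begin

abbreviation "par_act \<equiv> pact (pact scale)"
abbreviation "par_prod \<equiv> cprod (pact scale)"

definition val :: "('k \<Rightarrow> complex) \<Rightarrow> ('k, 'v) mpoly \<Rightarrow> 'v" where
  "val t = peval (\<lambda>v. v) t"

definition val2 :: "('l \<Rightarrow> complex) \<Rightarrow> ('k \<Rightarrow> complex) \<Rightarrow> ('l, ('k, 'v) mpoly) mpoly \<Rightarrow> 'v" where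
  "val2 y t = peval (val t) y"

lemma additive_val: "additive (val t)"
  unfolding val_def by (rule additive_peval) (standard, simp)

lemma additive_val2: "additive (val2 y t)"
  unfolding val2_def by (rule additive_peval) (rule additive_val)

lemmas val_simps [simp] =
  additive.zero[OF additive_val] additive.add[OF additive_val] additive.minus[OF additive_val]
  additive.diff[OF additive_val]
  additive.zero[OF additive_val2] additive.add[OF additive_val2] additive.minus[OF additive_val2]
  additive.diff[OF additive_val2]

lemmas val2_sum = additive.sum[OF additive_val2]

lemma val_cst [simp]: "val t (cst v) = v"
  by (simp add: val_def peval_cst)

lemma val2_cst [simp]: "val2 y t (cst p) = val t p"
  by (simp add: val2_def peval_cst)

lemma val_pact [simp]: "val t (pact scale q p) = scale (cval t q) (val t p)"
  unfolding val_def cval_def by (rule peval_pact) (simp_all add: additive_def)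

lemma val2_pact [simp]: "val2 y t (par_act Q P) = scale (cval2 y t Q) (val2 y t P)"
  unfolding val2_def cval2_def by (rule peval_pact) (rule additive_val, simp_all)

lemma val2_expand:
  "val2 y t P = (\<Sum>k\<in>Poly_Mapping.keys P. scale (monom_at y k) (val t (Poly_Mapping.lookup P k)))"
  by (simp add: val2_def peval_def)

lemma val2_psubst [simp]: "val2 y t (psubst (pact scale) X P) = val2 (pt y t X) t P"
  by (simp add: psubst_def val2_sum val2_expand[of "pt y t X"] monom_at_def) (simp add: pt_def)

lemma val2_cprod:
  "val2 y t (par_prod B P X Q) =
     (\<Sum>k\<in>Poly_Mapping.keys P. \<Sum>l\<in>Poly_Mapping.keys Q. scale (monom_at y k * monom_at y l)
       (val2 (pt y t X) t (B (Poly_Mapping.lookup P k) (Poly_Mapping.lookup Q l))))"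
  by (simp add: cprod_def val2_sum monom_at_add)

lemma val_eqI: "(\<And>t. val t p = val t q) \<Longrightarrow> p = q"
  by (rule poly_mapping_eqI) (rule peval_coeff_eq, simp_all add: val_def)

lemma val2_coeff_eq:
  "(\<And>y. val2 y t P = val2 y t' Q) \<Longrightarrow> val t (Poly_Mapping.lookup P k) = val t' (Poly_Mapping.lookup Q k)"
  by (rule peval_coeff_eq) (simp_all add: val2_def)

text \<open>All identities between elements of \<open>R[\<lambda>, \<mu>]\<close> below are proved by this extensionality principle.\<close>

lemma val2_eqI: "(\<And>y t. val2 y t P = val2 y t Q) \<Longrightarrow> P = Q"
  by (rule poly_mapping_eqI, rule val_eqI, rule val2_coeff_eq)

text \<open>Evaluation is jointly faithful and turns \<open>pact scale\<close> into \<open>scale\<close>, which satisfies the module laws.\<close>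

lemma module_pact: "module (pact scale :: ('k, complex) mpoly \<Rightarrow> ('k, 'v) mpoly \<Rightarrow> _)"
  by unfold_locales (rule val_eqI, simp add: algebra_simps)+

section \<open>Membership in modules of polynomials\<close>

definition agree :: "'k set \<Rightarrow> ('k \<Rightarrow> complex) \<Rightarrow> ('k \<Rightarrow> complex) \<Rightarrow> bool" where
  "agree I t t' \<longleftrightarrow> (\<forall>j\<in>I. t j = t' j)"

lemma agree_arith [simp]: "agree I t t"
  "agree I t t' \<Longrightarrow> agree I (- t) (- t')"
  "agree I s s' \<Longrightarrow> agree I t t' \<Longrightarrow> agree I (s + t) (s' + t')"
  "agree I s s' \<Longrightarrow> agree I t t' \<Longrightarrow> agree I (s - t) (s' - t')"
  by (auto simp: agree_def)

text \<open>Membership is a property of the values, so no closure property of \<open>polys\<close> has to be derived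
  from supports.\<close>

lemma mem_polys_iff:
  assumes "subspace W"
  shows "p \<in> polys I W \<longleftrightarrow> (\<forall>t. val t p \<in> W) \<and> (\<forall>t t'. agree I t t' \<longrightarrow> val t p = val t' p)"
proof (intro iffI conjI allI impI)
  fix t assume "p \<in> polys I W"
  then show "val t p \<in> W"
    unfolding val_def peval_def polys_def using assms by (auto intro!: subspace_sum subspace_scale)
next
  fix t t' assume "p \<in> polys I W" "agree I t t'"
  then show "val t p = val t' p"
    unfolding val_def by (intro peval_cong_on[where I = I]) (auto simp: polys_def agree_def)
next
  assume *: "(\<forall>t. val t p \<in> W) \<and> (\<forall>t t'. agree I t t' \<longrightarrow> val t p = val t' p)"
  have "Poly_Mapping.lookup p m \<in> W" for m
    using assms * by (intro peval_coeff_in[of W "\<lambda>v. v"]) (auto simp flip: val_def)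
  moreover have "Poly_Mapping.keys m \<subseteq> I" if "m \<in> Poly_Mapping.keys p" for m
    using * that by (intro peval_keys_subset[of "\<lambda>v. v" I p]) (auto simp: agree_def in_keys_iff simp flip: val_def)
  ultimately show "p \<in> polys I W"
    unfolding polys_def by auto
qed

lemma val_in: "subspace W \<Longrightarrow> p \<in> polys I W \<Longrightarrow> val t p \<in> W"
  by (simp add: mem_polys_iff)

lemma val_agree: "p \<in> polys I UNIV \<Longrightarrow> agree I t t' \<Longrightarrow> val t p = val t' p"
  by (simp add: mem_polys_iff)

lemma lookup_in_polysI:
  assumes "\<And>y t t'. agree I t t' \<Longrightarrow> val2 y t P = val2 y t' P"
  shows "Poly_Mapping.lookup P k \<in> polys I UNIV"
  using assms by (auto simp: mem_polys_iff intro!: val2_coeff_eq)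

lemma mem_polys2_iff:
  assumes W: "subspace W"
  shows "P \<in> polys I (polys I W) \<longleftrightarrow> (\<forall>x t. val2 x t P \<in> W) \<and>
    (\<forall>x x' t t'. agree I x x' \<longrightarrow> agree I t t' \<longrightarrow> val2 x t P = val2 x' t' P)"
proof (intro iffI conjI allI impI)
  fix x t assume "P \<in> polys I (polys I W)"
  then show "val2 x t P \<in> W"
    unfolding val2_expand polys_def[of I "polys I W"]
    using W by (auto intro!: subspace_sum subspace_scale val_in)
next
  fix x x' t t' assume P: "P \<in> polys I (polys I W)" and *: "agree I x x'" "agree I t t'"
  have "val t (Poly_Mapping.lookup P m) = val t' (Poly_Mapping.lookup P m)"
    if "m \<in> Poly_Mapping.keys P" for m
    using P that * W by (auto simp: polys_def[of I "polys I W"] mem_polys_iff)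
  then have "val2 x t P = val2 x t' P"
    by (simp add: val2_expand)
  also have "\<dots> = val2 x' t' P"
    unfolding val2_def using P * by (intro peval_cong_on[where I = I]) (auto simp: polys_def agree_def)
  finally show "val2 x t P = val2 x' t' P" .
next
  assume *: "(\<forall>x t. val2 x t P \<in> W) \<and>
    (\<forall>x x' t t'. agree I x x' \<longrightarrow> agree I t t' \<longrightarrow> val2 x t P = val2 x' t' P)"
  have "val t (Poly_Mapping.lookup P m) \<in> W" for t m
    using W * by (intro peval_coeff_in[of W "val t"]) (auto simp flip: val2_def)
  moreover have "Poly_Mapping.lookup P m \<in> polys I UNIV" for m
    using * by (intro lookup_in_polysI) auto
  ultimately have "Poly_Mapping.lookup P m \<in> polys I W" for m
    using W by (simp add: mem_polys_iff)
  moreover have "Poly_Mapping.keys m \<subseteq> I" if "m \<in> Poly_Mapping.keys P" for m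
  proof -
    have "\<exists>t. val t (Poly_Mapping.lookup P m) \<noteq> 0"
      using that val_eqI[of "Poly_Mapping.lookup P m" 0] by (auto simp: in_keys_iff)
    then obtain t where "val t (Poly_Mapping.lookup P m) \<noteq> 0" by blast
    then show ?thesis
      using * by (intro peval_keys_subset[of "val t" I P]) (auto simp: agree_def simp flip: val2_def)
  qed
  ultimately show "P \<in> polys I (polys I W)"
    unfolding polys_def[of I "polys I W"] by auto
qed

end

lemma exponent_induct:
  assumes "Poly_Mapping.keys m \<subseteq> I" "Q 0"
    and step: "\<And>m j. j \<in> I \<Longrightarrow> Poly_Mapping.keys m \<subseteq> I \<Longrightarrow> Q m \<Longrightarrow> Q (Poly_Mapping.single j (1::nat) + m)"
  shows "Q m"
proof -
  have "Poly_Mapping.keys (\<Sum>j\<in>S. Poly_Mapping.single j (Poly_Mapping.lookup m j)) \<subseteq> I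
      \<and> Q (\<Sum>j\<in>S. Poly_Mapping.single j (Poly_Mapping.lookup m j))"
    if "finite S" "S \<subseteq> I" for S
    using that
  proof (induction S)
    case (insert j S)
    let ?r = "\<Sum>j\<in>S. Poly_Mapping.single j (Poly_Mapping.lookup m j)"
    have "Poly_Mapping.keys (Poly_Mapping.single j n + ?r) \<subseteq> I \<and> Q (Poly_Mapping.single j n + ?r)" for n
    proof (induction n)
      case (Suc n)
      have *: "Poly_Mapping.single j (Suc n) + ?r
          = Poly_Mapping.single j 1 + (Poly_Mapping.single j n + ?r)"
        by (simp flip: add.assoc single_add)
      show ?case
        using Suc insert.prems keys_add[of "Poly_Mapping.single j 1" "Poly_Mapping.single j n + ?r"]
        unfolding * by (intro conjI step) auto
    qed (use insert in simp)
    then show ?case using insert by simp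
  qed (use assms in simp)
  from this[of "Poly_Mapping.keys m"] assms show ?thesis
    by (simp flip: poly_mapping_sum_single)
qed

lemma pact_var_single:
  assumes "\<And>c. act c 0 = 0"
  shows "pact act (var j) (Poly_Mapping.single m a) = Poly_Mapping.single (Poly_Mapping.single j 1 + m) (act 1 a)"
  by (cases "a = 0") (simp_all add: pact_def var_def assms)

text \<open>Every polynomial arises from constants by addition and multiplication by variables. The
  sesquilinearity axioms speak about exactly these steps.\<close>

lemma polys_induct:
  assumes p: "p \<in> polys I A" and act: "\<And>c. act c 0 = 0" "\<And>a. act 1 a = a"
    and zero: "Q 0" and cst: "\<And>a. a \<in> A \<Longrightarrow> Q (cst a)"
    and add: "\<And>p q. Q p \<Longrightarrow> Q q \<Longrightarrow> Q (p + q)"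
    and var: "\<And>p j. j \<in> I \<Longrightarrow> Q p \<Longrightarrow> Q (pact act (var j) p)"
  shows "Q p"
proof -
  have *: "Q (Poly_Mapping.single m a)" if "a \<in> A" "Poly_Mapping.keys m \<subseteq> I" for m a
    using that(2)
  proof (rule exponent_induct)
    show "Q (Poly_Mapping.single 0 a)"
      using cst[OF that(1)] by (simp add: cst_def)
    show "Q (Poly_Mapping.single (Poly_Mapping.single j 1 + m) a)"
      if "j \<in> I" "Q (Poly_Mapping.single m a)" for m j
      using var[OF that] by (simp add: pact_var_single act)
  qed
  have "Q (\<Sum>k\<in>S. Poly_Mapping.single k (Poly_Mapping.lookup p k))" if "S \<subseteq> Poly_Mapping.keys p" for S
    using finite_subset[OF that finite_keys] that
    by (induction S) (use p in \<open>auto simp: zero polys_def intro!: add *\<close>)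
  from this[of "Poly_Mapping.keys p"] show ?thesis
    by (simp flip: poly_mapping_sum_single)
qed

section \<open>Polynomial functions of two points\<close>

context complex_space begin

text \<open>The polynomial functions with values in \<open>V\<close>, in the coordinates of two points indexed by \<open>I\<close>.
  As functions, they can be composed with changes of momenta, which would be awkward for the
  polynomials themselves.\<close>

inductive_set pfuns :: "nat set \<Rightarrow> ((nat \<Rightarrow> complex) \<Rightarrow> (nat \<Rightarrow> complex) \<Rightarrow> 'v) set" for I where
  const: "(\<lambda>p q. v) \<in> pfuns I"
| add: "f \<in> pfuns I \<Longrightarrow> g \<in> pfuns I \<Longrightarrow> (\<lambda>p q. f p q + g p q) \<in> pfuns I"
| fst: "f \<in> pfuns I \<Longrightarrow> j \<in> I \<Longrightarrow> (\<lambda>p q. scale (p j) (f p q)) \<in> pfuns I"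
| snd: "f \<in> pfuns I \<Longrightarrow> j \<in> I \<Longrightarrow> (\<lambda>p q. scale (q j) (f p q)) \<in> pfuns I"

lemma pfuns_scale: "f \<in> pfuns I \<Longrightarrow> (\<lambda>p q. scale c (f p q)) \<in> pfuns I"
proof (induction rule: pfuns.induct)
  case (fst f j)
  then show ?case using pfuns.fst[OF fst.IH fst.hyps(2)] by (simp add: mult.commute)
next
  case (snd f j)
  then show ?case using pfuns.snd[OF snd.IH snd.hyps(2)] by (simp add: mult.commute)
qed (auto simp: scale_right_distrib intro: pfuns.intros)

lemma pfuns_diff: "f \<in> pfuns I \<Longrightarrow> g \<in> pfuns I \<Longrightarrow> (\<lambda>p q. f p q - g p q) \<in> pfuns I"
  using pfuns.add[OF _ pfuns_scale[of g I "-1"], of f] by simp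

lemma pfuns_uminus: "f \<in> pfuns I \<Longrightarrow> (\<lambda>p q. - f p q) \<in> pfuns I"
  using pfuns_scale[of f I "-1"] by simp

lemma pfuns_swap: "f \<in> pfuns I \<Longrightarrow> (\<lambda>p q. f q p) \<in> pfuns I"
  by (induction rule: pfuns.induct) (auto intro: pfuns.intros)

text \<open>The coordinates \<open>(\<lambda>, T)\<close> and the pair of momenta \<open>(p, q)\<close> are related by the involution
  \<open>(p, q) \<mapsto> (p, - p - q)\<close>.\<close>

lemma pfuns_dual: "f \<in> pfuns I \<Longrightarrow> (\<lambda>p q. f p (- p - q)) \<in> pfuns I"
proof (induction rule: pfuns.induct)
  case (snd f j)
  have "(\<lambda>p q. - scale (p j) (f p (- p - q)) - scale (q j) (f p (- p - q))) \<in> pfuns I"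
    using snd by (intro pfuns_diff pfuns_uminus pfuns.fst pfuns.snd)
  moreover have "(\<lambda>p q. - scale (p j) (f p (- p - q)) - scale (q j) (f p (- p - q)))
      = (\<lambda>p q. scale ((- p - q) j) (f p (- p - q)))"
    by (intro ext) (simp add: scale_left_diff_distrib)
  ultimately show ?case by (simp only:)
qed (auto intro: pfuns.intros)

lemma pfuns_agree: "f \<in> pfuns I \<Longrightarrow> agree I p p' \<Longrightarrow> agree I q q' \<Longrightarrow> f p q = f p' q'"
  by (induction rule: pfuns.induct) (auto simp: agree_def)

lemma pfuns_mono: "f \<in> pfuns J \<Longrightarrow> J \<subseteq> I \<Longrightarrow> f \<in> pfuns I"
  by (induction rule: pfuns.induct) (auto intro: pfuns.intros)

lemma val_pfuns:
  assumes "P \<in> polys I UNIV"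
  shows "(\<lambda>x t. val t P) \<in> pfuns I"
  by (rule polys_induct[OF assms, of scale]) (auto intro: pfuns.intros)

lemma val2_pfuns:
  assumes "P \<in> polys I (polys I UNIV)"
  shows "(\<lambda>x t. val2 x t P) \<in> pfuns I"
proof (rule polys_induct[OF assms, of "pact scale"])
  interpret pact: module "pact scale :: (nat, complex) mpoly \<Rightarrow> (nat, 'v) mpoly \<Rightarrow> _" by (rule module_pact)
  show "pact scale c 0 = 0" "pact scale 1 a = a" for c :: ctpoly and a :: "(nat, 'v) mpoly" by simp_all
  have *: "cval2 x t (var j) = x j" for x t :: "nat \<Rightarrow> complex" and j
    by (simp add: var_def)
  show "(\<lambda>x t. val2 x t (par_act (var j) P)) \<in> pfuns I"
    if "j \<in> I" "(\<lambda>x t. val2 x t P) \<in> pfuns I" for P j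
    using that by (simp add: * pfuns.fst)
qed (auto intro: pfuns.intros val_pfuns)

lemma pfuns_val2:
  assumes "f \<in> pfuns I"
  obtains P where "P \<in> polys I (polys I UNIV)" "\<And>x t. val2 x t P = f x t"
proof -
  have "\<exists>P. \<forall>x t. val2 x t P = f x t"
    using assms
  proof (induction rule: pfuns.induct)
    case (const v)
    show ?case by (rule exI[of _ "cst (cst v)"]) simp
  next
    case (add f g)
    then obtain P Q where "\<forall>x t. val2 x t P = f x t" "\<forall>x t. val2 x t Q = g x t" by blast
    then show ?case by (intro exI[of _ "P + Q"]) simp
  next
    case (fst f j)
    then obtain P where "\<forall>x t. val2 x t P = f x t" by blast
    then show ?case by (intro exI[of _ "par_act (var j) P"]) (simp add: var_def)
  next
    case (snd f j)
    then obtain P where "\<forall>x t. val2 x t P = f x t" by blast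
    then show ?case by (intro exI[of _ "par_act (cst (var j)) P"]) simp
  qed
  then obtain P where P: "\<And>x t. val2 x t P = f x t" by blast
  then have "P \<in> polys I (polys I UNIV)"
    using pfuns_agree[OF assms] by (simp add: mem_polys2_iff)
  then show thesis using P that by blast
qed

end

section \<open>Conformal products as families of bilinear maps\<close>

type_synonym momentum = "nat \<Rightarrow> complex"

type_synonym 'v free_product = "(nat, 'v) mpoly \<Rightarrow> (nat, 'v) mpoly \<Rightarrow> (nat, (nat, 'v) mpoly) mpoly"

text \<open>Binary operations that depend on the momenta of their two arguments.\<close>

type_synonym 'v family = "'v \<Rightarrow> 'v \<Rightarrow> momentum \<Rightarrow> momentum \<Rightarrow> 'v"

locale graded_space = complex_space scale
  for scale :: "complex \<Rightarrow> 'v::ab_group_add \<Rightarrow> 'v" +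
  fixes V :: "bit \<Rightarrow> 'v set"
  assumes graded: "graded_module UNIV scale V" and total: "total_space V = UNIV"
begin

lemma subspace_V: "subspace (V \<alpha>)"
  using graded unfolding graded_module_def subspace_def by auto

lemma V_cases:
  obtains u w where "u \<in> V 0" "w \<in> V 1" "v = u + w"
  using total unfolding total_space_def by blast

lemma V_disjoint: "v \<in> V 0 \<Longrightarrow> v \<in> V 1 \<Longrightarrow> v = 0"
  using graded unfolding graded_module_def by auto

lemma cval_agree: "q \<in> polys I UNIV \<Longrightarrow> agree I t t' \<Longrightarrow> cval t q = cval t' q"
  unfolding cval_def by (rule cplx.peval_cong_on[where I = I]) (auto simp: polys_def agree_def)

lemma cst_add: "cst (a + b) = cst a + cst b"
  by (simp add: cst_def single_add)

lemma cst_in_polys [simp]: "v \<in> A \<Longrightarrow> cst v \<in> polys I A"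
  by (auto simp: cst_def polys_def)

lemma add_in_polys:
  assumes "subspace W" "p \<in> polys I W" "q \<in> polys I W"
  shows "p + q \<in> polys I W"
  using assms unfolding mem_polys_iff[OF assms(1)]
  by (auto intro: subspace_add arg_cong2[where f = "(+)"])

lemma pact_in_polys:
  assumes "q \<in> polys I UNIV" "p \<in> polys I W" "subspace W"
  shows "pact scale q p \<in> polys I W"
  using assms cval_agree[OF assms(1)] by (auto simp: mem_polys_iff intro: subspace_scale arg_cong2[where f = scale])

lemma var_in_polys [simp]: "j \<in> I \<Longrightarrow> (var j :: ('k, complex) mpoly) \<in> polys I UNIV"
  by (simp add: var_def polys_def)

lemma polys_UNIV_induct [consumes 1, case_names zero cst add var]:
  assumes p: "p \<in> polys I UNIV" and zero: "Q 0" and cst: "\<And>a. Q (cst a)"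
    and add: "\<And>p q. p \<in> polys I UNIV \<Longrightarrow> q \<in> polys I UNIV \<Longrightarrow> Q p \<Longrightarrow> Q q \<Longrightarrow> Q (p + q)"
    and var: "\<And>p j. j \<in> I \<Longrightarrow> p \<in> polys I UNIV \<Longrightarrow> Q p \<Longrightarrow> Q (pact scale (var j) p)"
  shows "Q p"
proof -
  have "p \<in> polys I UNIV \<and> Q p"
    by (rule polys_induct[OF p, of scale])
      (auto simp: zero cst mem_polys_iff[of UNIV 0] intro!: add_in_polys pact_in_polys var_in_polys add var)
  then show ?thesis ..
qed

lemma total_space_free: "total_space (free_pieces I V) = polys I UNIV"
proof (intro equalityI subsetI)
  fix p assume "p \<in> total_space (free_pieces I V)"
  then show "p \<in> polys I UNIV"
    unfolding total_space_def free_pieces_def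
    by (auto intro!: add_in_polys) (auto simp: polys_def)
next
  have sub: "subspace (V \<alpha>)" for \<alpha> by (rule subspace_V)
  fix p :: "(nat, 'v) mpoly" assume "p \<in> polys I UNIV"
  then have "\<exists>u\<in>polys I (V 0). \<exists>w\<in>polys I (V 1). p = u + w"
  proof (induction rule: polys_UNIV_induct)
    case zero
    have "(0 :: (nat, 'v) mpoly) \<in> polys I (V \<alpha>)" for \<alpha> by (simp add: polys_def)
    then show ?case by (metis add.right_neutral)
  next
    case (cst v)
    obtain u w where "u \<in> V 0" "w \<in> V 1" "v = u + w" by (rule V_cases)
    then have "cst u \<in> polys I (V 0)" "cst w \<in> polys I (V 1)" "cst v = cst u + cst w"
      by (simp_all add: cst_add)
    then show ?case by blast
  next
    case (add p q)
    then obtain u w u' w' where *: "u \<in> polys I (V 0)" "w \<in> polys I (V 1)" "p = u + w"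
      "u' \<in> polys I (V 0)" "w' \<in> polys I (V 1)" "q = u' + w'" by blast
    then have "p + q = (u + u') + (w + w')" by simp
    with * show ?case by (metis add_in_polys sub)
  next
    case (var p j)
    then obtain u w where "u \<in> polys I (V 0)" "w \<in> polys I (V 1)" "p = u + w" by blast
    moreover from this have "pact scale (var j) p = pact scale (var j) u + pact scale (var j) w"
      by (intro val_eqI) (simp add: scale_right_distrib)
    ultimately show ?case
      using var(1) sub by (metis pact_in_polys var_in_polys)
  qed
  then show "p \<in> total_space (free_pieces I V)"
    unfolding total_space_def free_pieces_def by blast
qed

lemma free_pieces_subset: "p \<in> free_pieces I V \<alpha> \<Longrightarrow> p \<in> polys I UNIV"
  by (auto simp: free_pieces_def polys_def)

lemma val_free_pieces: "p \<in> free_pieces I V \<alpha> \<Longrightarrow> val t p \<in> V \<alpha>"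
  by (simp add: free_pieces_def val_in subspace_V)

lemma graded_module_free: "graded_module (polys I UNIV) (pact scale) (free_pieces I V)"
  unfolding graded_module_def
proof (intro conjI allI ballI)
  show "module (pact scale :: ctpoly \<Rightarrow> (nat, 'v) mpoly \<Rightarrow> _)" by (rule module_pact)
  fix \<alpha> :: bit
  show "0 \<in> free_pieces I V \<alpha>" by (simp add: free_pieces_def polys_def)
  fix x assume x: "x \<in> free_pieces I V \<alpha>"
  show "pact scale p x \<in> free_pieces I V \<alpha>" if "p \<in> polys I UNIV" for p
    using x that subspace_V by (simp add: free_pieces_def pact_in_polys)
  fix y assume "y \<in> free_pieces I V \<alpha>"
  then show "x + y \<in> free_pieces I V \<alpha>"
    using x by (simp add: free_pieces_def add_in_polys subspace_V)
next
  show "free_pieces I V 0 \<inter> free_pieces I V 1 = {0}"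
  proof (intro equalityI subsetI)
    fix x assume "x \<in> free_pieces I V 0 \<inter> free_pieces I V 1"
    then have "val t x = 0" for t
      by (auto intro: V_disjoint val_free_pieces)
    then have "x = 0" by (intro val_eqI) simp
    then show "x \<in> {0}" by simp
  qed (auto simp: free_pieces_def polys_def)
qed

text \<open>The families of bilinear maps on \<open>V\<close> that come from a conformal product on the free module in
  the variables \<open>I\<close>.\<close>

definition kernel :: "nat set \<Rightarrow> 'v family \<Rightarrow> bool" where
  "kernel I f \<longleftrightarrow>
     (\<forall>a a' b p q. f (a + a') b p q = f a b p q + f a' b p q \<and> f b (a + a') p q = f b a p q + f b a' p q) \<and>
     (\<forall>z a b p q. f (scale z a) b p q = scale z (f a b p q) \<and> f a (scale z b) p q = scale z (f a b p q)) \<and>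
     (\<forall>\<alpha> \<beta>. \<forall>a\<in>V \<alpha>. \<forall>b\<in>V \<beta>. \<forall>p q. f a b p q \<in> V (\<alpha> + \<beta>)) \<and>
     (\<forall>a b. f a b \<in> pfuns I)"

lemma
  assumes "kernel I f"
  shows kernel_add: "f (a + a') b p q = f a b p q + f a' b p q" "f b (a + a') p q = f b a p q + f b a' p q"
    and kernel_scale: "f (scale z a) b p q = scale z (f a b p q)" "f a (scale z b) p q = scale z (f a b p q)"
    and kernel_graded: "a \<in> V \<alpha> \<Longrightarrow> b \<in> V \<beta> \<Longrightarrow> f a b p q \<in> V (\<alpha> + \<beta>)"
    and kernel_pfuns: "f a b \<in> pfuns I"
  using assms unfolding kernel_def by blast+

lemma
  assumes "kernel I f"
  shows kernel_0: "f 0 b p q = 0" "f a 0 p q = 0"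
    and kernel_minus: "f (- a) b p q = - f a b p q" "f a (- b) p q = - f a b p q"
    and kernel_diff: "f (a - a') b p q = f a b p q - f a' b p q" "f b (a - a') p q = f b a p q - f b a' p q"
    and kernel_sum: "f (sum g A) b p q = (\<Sum>x\<in>A. f (g x) b p q)" "f a (sum g A) p q = (\<Sum>x\<in>A. f a (g x) p q)"
proof -
  interpret l: additive "\<lambda>a. f a b p q" by standard (rule kernel_add(1)[OF assms])
  interpret r: additive "\<lambda>b. f a b p q" for a by standard (rule kernel_add(2)[OF assms])
  show "f 0 b p q = 0" "f a 0 p q = 0" "f (- a) b p q = - f a b p q" "f a (- b) p q = - f a b p q"
    "f (a - a') b p q = f a b p q - f a' b p q" "f b (a - a') p q = f b a p q - f b a' p q"
    "f (sum g A) b p q = (\<Sum>x\<in>A. f (g x) b p q)" "f a (sum g A) p q = (\<Sum>x\<in>A. f a (g x) p q)"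
    by (fact l.zero r.zero l.minus r.minus l.diff r.diff l.sum r.sum)+
qed

lemma kernel_agree: "kernel I f \<Longrightarrow> agree I p p' \<Longrightarrow> agree I q q' \<Longrightarrow> f a b p q = f a b p' q'"
  by (rule pfuns_agree[OF kernel_pfuns])

text \<open>The value of a product of arbitrary elements: \<open>T\<close> acts on the left factor as \<open>- \<lambda>\<close> and on the right
  factor as \<open>T + \<lambda>\<close>. The second momentum \<open>- x - t\<close> makes the total momentum equal to \<open>- t\<close>.\<close>

definition represents ::
  "nat set \<Rightarrow> 'v free_product \<Rightarrow> 'v family \<Rightarrow> bool" where
  "represents I B f \<longleftrightarrow> (\<forall>P\<in>polys I UNIV. \<forall>Q\<in>polys I UNIV. \<forall>x t.
     val2 x t (B P Q) = f (val (- x) P) (val (x + t) Q) x (- x - t))"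

definition kernel_of :: "'v free_product \<Rightarrow> 'v family" where
  "kernel_of B a b p q = val2 p (- p - q) (B (cst a) (cst b))"

definition product_of ::
  "nat set \<Rightarrow> 'v family \<Rightarrow> 'v free_product" where
  "product_of I f = (\<lambda>P\<in>polys I UNIV. \<lambda>Q\<in>polys I UNIV.
     SOME R. \<forall>x t. val2 x t R = f (val (- x) P) (val (x + t) Q) x (- x - t))"

lemma represents_kernel_of: "represents I B f \<Longrightarrow> kernel_of B = f"
  unfolding represents_def kernel_of_def by (intro ext) simp

text \<open>Products are extensional, so there is no freedom left outside the carrier.\<close>

lemma represents_unique:
  assumes "represents I B f" "represents I B' f"
    and "B \<in> polys I UNIV \<rightarrow>\<^sub>E polys I UNIV \<rightarrow>\<^sub>E S" "B' \<in> polys I UNIV \<rightarrow>\<^sub>E polys I UNIV \<rightarrow>\<^sub>E S"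
  shows "B = B'"
proof (rule PiE_ext[OF assms(3,4)])
  fix P assume P: "P \<in> polys I (UNIV :: 'v set)"
  show "B P = B' P"
  proof (rule PiE_ext)
    show "B P \<in> polys I UNIV \<rightarrow>\<^sub>E S" "B' P \<in> polys I UNIV \<rightarrow>\<^sub>E S"
      using assms(3,4) P by auto
    show "B P Q = B' P Q" if "Q \<in> polys I UNIV" for Q
      using assms(1,2) P that unfolding represents_def by (intro val2_eqI) simp
  qed
qed

text \<open>A factor \<open>0\<close> has no keys, which makes the left side vanish; hence the two hypotheses.\<close>

lemma val2_cprod_cst:
  assumes "B 0 Q = 0" "B P 0 = 0"
  shows "val2 (y :: nat + nat \<Rightarrow> complex) t (par_prod B (cst P) X (cst Q)) = val2 (pt y t X) t (B P Q)"
proof -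
  have keys: "Poly_Mapping.keys (cst p) = (if p = 0 then {} else {0 :: nat + nat \<Rightarrow>\<^sub>0 nat})" for p :: "(nat, 'v) mpoly"
    by (simp add: cst_def)
  have "Poly_Mapping.lookup (cst p) (0 :: nat + nat \<Rightarrow>\<^sub>0 nat) = p" for p :: "(nat, 'v) mpoly"
    by (simp add: cst_def)
  then show ?thesis
    using assms by (auto simp: val2_cprod keys)
qed

text \<open>A conformal product is determined by its values on generators. On generators \<open>represents\<close> holds by
  the choice of momenta, and sesquilinearity propagates it along \<open>polys_UNIV_induct\<close>, first in the right
  factor and then in the left one.\<close>

lemma conformal_product_kernel:
  assumes B: "conformal_product I (pact scale) (free_pieces I V) B"
  shows "kernel I (kernel_of B)" "represents I B (kernel_of B)"
proof -
  note B' = B[unfolded conformal_product_def total_space_free]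
  have ext: "B \<in> polys I UNIV \<rightarrow>\<^sub>E polys I UNIV \<rightarrow>\<^sub>E polys I (polys I UNIV)"
    using B' by blast
  have gr: "B a b \<in> polys I (free_pieces I V (\<alpha> + \<beta>))" if "a \<in> free_pieces I V \<alpha>" "b \<in> free_pieces I V \<beta>" for a b \<alpha> \<beta>
    using B' that by blast
  have Badd: "B (a + a') b = B a b + B a' b" "B b (a + a') = B b a + B b a'"
    if "a \<in> polys I UNIV" "a' \<in> polys I UNIV" "b \<in> polys I UNIV" for a a' b
    using B' that by blast+
  have scal: "B (pact scale (cst z) a) b = par_act (cst (cst z)) (B a b)"
    "B a (pact scale (cst z) b) = par_act (cst (cst z)) (B a b)"
    if "a \<in> polys I UNIV" "b \<in> polys I UNIV" for z a b
    using B' that by blast+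
  have T: "par_prod B (cst (pact scale (var j) a)) lam (cst b) =
          par_act (- lam j) (par_prod B (cst a) lam (cst b))"
     "par_prod B (cst a) lam (cst (pact scale (var j) b)) =
          par_act (TT j + lam j) (par_prod B (cst a) lam (cst b))"
    if "j \<in> I" "a \<in> polys I UNIV" "b \<in> polys I UNIV" for j a b
    using B' that by blast+
  have 0: "0 \<in> polys I (UNIV :: 'v set)" by (simp add: polys_def)
  have Bzero: "B 0 b = 0" "B b 0 = 0" if "b \<in> polys I UNIV" for b
    using Badd[OF 0 0 that] by simp_all
  have T': "val2 x t (B (pact scale (var j) a) b) = scale (- x j) (val2 x t (B a b))"
    "val2 x t (B a (pact scale (var j) b)) = scale (t j + x j) (val2 x t (B a b))"
    if j: "j \<in> I" and ab: "a \<in> polys I UNIV" "b \<in> polys I UNIV" for x t j a b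
  proof -
    have j': "pact scale (var j) p \<in> polys I UNIV" if "p \<in> polys I UNIV" for p :: "(nat, 'v) mpoly"
      using that j by (simp add: pact_in_polys)
    show "val2 x t (B (pact scale (var j) a) b) = scale (- x j) (val2 x t (B a b))"
      using arg_cong[OF T(1)[OF j ab], of "val2 (case_sum x x) t"] ab j'
      by (simp add: val2_cprod_cst Bzero)
    show "val2 x t (B a (pact scale (var j) b)) = scale (t j + x j) (val2 x t (B a b))"
      using arg_cong[OF T(2)[OF j ab], of "val2 (case_sum x x) t"] ab j'
      by (simp add: val2_cprod_cst Bzero)
  qed
  have cst_scale: "cst (scale z a) = pact scale (cst z) (cst a)" for z a
    by (rule val_eqI) simp
  show kernel: "kernel I (kernel_of B)"
    unfolding kernel_def
  proof (intro conjI allI ballI)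
    fix a a' b p q
    show "kernel_of B (a + a') b p q = kernel_of B a b p q + kernel_of B a' b p q"
      "kernel_of B b (a + a') p q = kernel_of B b a p q + kernel_of B b a' p q"
      by (simp_all add: kernel_of_def cst_add Badd)
  next
    fix z a b p q
    show "kernel_of B (scale z a) b p q = scale z (kernel_of B a b p q)"
      "kernel_of B a (scale z b) p q = scale z (kernel_of B a b p q)"
      by (simp_all add: kernel_of_def cst_scale scal)
  next
    fix \<alpha> \<beta> a b p q assume "a \<in> V \<alpha>" "b \<in> V \<beta>"
    then have "B (cst a) (cst b) \<in> polys I (polys I (V (\<alpha> + \<beta>)))"
      using gr[of "cst a" \<alpha> "cst b" \<beta>] by (simp add: free_pieces_def)
    then show "kernel_of B a b p q \<in> V (\<alpha> + \<beta>)"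
      by (simp add: kernel_of_def mem_polys2_iff subspace_V)
  next
    fix a b
    have "B (cst a) (cst b) \<in> polys I (polys I UNIV)"
      using ext by (auto simp: PiE_iff)
    from pfuns_dual[OF val2_pfuns[OF this]] show "kernel_of B a b \<in> pfuns I"
      by (simp add: kernel_of_def[abs_def])
  qed
  have inner: "val2 x t (B (cst a) Q) = kernel_of B a (val (x + t) Q) x (- x - t)"
    if "Q \<in> polys I UNIV" for a Q x t
    using that
  proof (induction rule: polys_UNIV_induct)
    case zero
    then show ?case by (simp add: kernel_0[OF kernel] Bzero)
  next
    case (cst b)
    then show ?case by (simp add: kernel_of_def fun_diff_def fun_Compl_def)
  next
    case (add Q Q')
    then show ?case by (simp add: Badd kernel_add[OF kernel])
  next
    case (var Q j)
    then show ?case by (simp add: T' kernel_scale[OF kernel] add.commute)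
  qed
  have "val2 x t (B P Q) = kernel_of B (val (- x) P) (val (x + t) Q) x (- x - t)"
    if "P \<in> polys I UNIV" "Q \<in> polys I UNIV" for P Q x t
    using that
  proof (induction rule: polys_UNIV_induct)
    case zero
    then show ?case by (simp add: kernel_0[OF kernel] Bzero)
  next
    case (cst b)
    then show ?case by (simp add: inner plus_fun_def fun_diff_def fun_Compl_def)
  next
    case (add Q Q')
    then show ?case by (simp add: Badd kernel_add[OF kernel])
  next
    case (var Q j)
    then show ?case by (simp add: T' kernel_scale[OF kernel] kernel_minus[OF kernel])
  qed
  then show "represents I B (kernel_of B)"
    by (simp add: represents_def)
qed

text \<open>The values prescribed by \<open>represents\<close> are again polynomial, so some polynomial takes them. This
  is what makes \<open>product_of\<close> well defined.\<close>

lemma kernel_pfuns_extended: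
  assumes f: "kernel I f" and P: "P \<in> polys I UNIV" and Q: "Q \<in> polys I UNIV"
  shows "(\<lambda>x t. f (val (- x) P) (val (x + t) Q) x (- x - t)) \<in> pfuns I"
proof -
  have "(\<lambda>x t. f a (val (x + t) Q) x (- x - t)) \<in> pfuns I" for a
    using Q
  proof (induction rule: polys_UNIV_induct)
    case (var Q j)
    from pfuns.add[OF pfuns.fst[OF this(3,1)] pfuns.snd[OF this(3,1)]]
    show ?case by (simp add: kernel_scale[OF f] kernel_add[OF f] scale_left_distrib)
  next
    case (cst b)
    show ?case
      using pfuns_dual[OF kernel_pfuns[OF f]] by (simp add: fun_diff_def fun_Compl_def)
  qed (auto simp: kernel_0[OF f] kernel_add[OF f] intro: pfuns.intros)
  with P show ?thesis
  proof (induction rule: polys_UNIV_induct)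
    case (var P j)
    from pfuns_uminus[OF pfuns.fst[OF var(3)[OF var(4)] var(1)]]
    show ?case by (simp add: kernel_scale[OF f] kernel_minus[OF f])
  qed (auto simp: kernel_0[OF f] kernel_add[OF f] intro: pfuns.intros)
qed

lemma val2_product_of:
  assumes f: "kernel I f" and P: "P \<in> polys I UNIV" and Q: "Q \<in> polys I UNIV"
  shows "val2 x t (product_of I f P Q) = f (val (- x) P) (val (x + t) Q) x (- x - t)"
proof -
  have "\<exists>R. \<forall>x t. val2 x t R = f (val (- x) P) (val (x + t) Q) x (- x - t)"
    using pfuns_val2[OF kernel_pfuns_extended[OF assms]] by metis
  from someI_ex[OF this] show ?thesis
    using P Q by (simp add: product_of_def)
qed

lemma represents_product_of: "kernel I f \<Longrightarrow> represents I (product_of I f) f"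
  by (simp add: represents_def val2_product_of)

lemma product_of_in_polys:
  assumes f: "kernel I f" and W: "subspace W" and P: "P \<in> polys I UNIV" and Q: "Q \<in> polys I UNIV"
    and "\<And>x t. f (val (- x) P) (val (x + t) Q) x (- x - t) \<in> W"
  shows "product_of I f P Q \<in> polys I (polys I W)"
  unfolding mem_polys2_iff[OF W]
  using assms pfuns_agree[OF kernel_pfuns_extended[OF f P Q]] by (simp add: val2_product_of)

text \<open>Each axiom is an identity between values of \<open>f\<close>, by \<open>val2_product_of\<close> and extensionality.\<close>

lemma conformal_product_of:
  assumes f: "kernel I f"
  shows "conformal_product I (pact scale) (free_pieces I V) (product_of I f)"
  unfolding conformal_product_def total_space_free
proof (intro conjI allI ballI)
  let ?B = "product_of I f"
  note val = val2_product_of[OF f]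
  have 0: "0 \<in> polys I (UNIV :: 'v set)" by (simp add: polys_def)
  have zero: "?B 0 b = 0" "?B b 0 = 0" if "b \<in> polys I UNIV" for b
    using that by (intro val2_eqI, simp add: val 0 kernel_0[OF f])+
  show "graded_module (polys I UNIV) (pact scale) (free_pieces I V)" by (rule graded_module_free)
  show "?B \<in> polys I UNIV \<rightarrow>\<^sub>E polys I UNIV \<rightarrow>\<^sub>E polys I (polys I UNIV)"
  proof (intro PiE_I)
    show "?B P Q \<in> polys I (polys I UNIV)" if "P \<in> polys I UNIV" "Q \<in> polys I UNIV" for P Q
      using that by (intro product_of_in_polys f) auto
  qed (simp_all add: product_of_def)
  show "?B a b \<in> polys I (free_pieces I V (\<alpha> + \<beta>))"
    if "a \<in> free_pieces I V \<alpha>" "b \<in> free_pieces I V \<beta>" for \<alpha> \<beta> a b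
    unfolding free_pieces_def using that
    by (intro product_of_in_polys f subspace_V kernel_graded[OF f] val_free_pieces) (auto dest: free_pieces_subset)
  fix a b assume a: "a \<in> polys I (UNIV :: 'v set)" and b: "b \<in> polys I (UNIV :: 'v set)"
  { fix a' assume a': "a' \<in> polys I (UNIV :: 'v set)"
    show "?B (a + a') b = ?B a b + ?B a' b" "?B b (a + a') = ?B b a + ?B b a'"
      using a b a' by (intro val2_eqI, simp add: val add_in_polys kernel_add[OF f])+ }
  { fix z
    have z: "pact scale (cst z) p \<in> polys I UNIV" if "p \<in> polys I UNIV" for p :: "(nat, 'v) mpoly"
      using that by (intro pact_in_polys) auto
    show "?B (pact scale (cst z) a) b = par_act (cst (cst z)) (?B a b)"
      "?B a (pact scale (cst z) b) = par_act (cst (cst z)) (?B a b)"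
      using a b by (intro val2_eqI, simp add: val z kernel_scale[OF f])+ }
  { fix j assume j: "j \<in> I"
    have j': "pact scale (var j) p \<in> polys I UNIV" if "p \<in> polys I UNIV" for p :: "(nat, 'v) mpoly"
      using that j by (intro pact_in_polys) auto
    show "par_prod ?B (cst (pact scale (var j) a)) lam (cst b) =
          par_act (- lam j) (par_prod ?B (cst a) lam (cst b))"
      "par_prod ?B (cst a) lam (cst (pact scale (var j) b)) =
          par_act (TT j + lam j) (par_prod ?B (cst a) lam (cst b))"
      using a b j' by (intro val2_eqI, simp add: val2_cprod_cst zero val kernel_scale[OF f] kernel_minus[OF f] kernel_add[OF f] scale_left_distrib add.commute)+ }
qed


section \<open>The axioms in terms of kernels\<close>

text \<open>Nested products are governed by \<open>represents\<close> only if the coefficients of the inner product lie in the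
  free module. This is so for substituted tuples \<open>X\<close> whose entries with index in \<open>I\<close> involve no \<open>T\<^sub>j\<close>
  with \<open>j\<close> outside \<open>I\<close>.\<close>

definition coeffs_in :: "nat set \<Rightarrow> ('k, (nat, 'v) mpoly) mpoly \<Rightarrow> bool" where
  "coeffs_in I P \<longleftrightarrow> (\<forall>k. Poly_Mapping.lookup P k \<in> polys I UNIV)"

definition internal :: "nat set \<Rightarrow> (nat \<Rightarrow> ctpoly par) \<Rightarrow> bool" where
  "internal I X \<longleftrightarrow> (\<forall>y t t'. agree I t t' \<longrightarrow> agree I (pt y t X) (pt y t' X))"

lemma coeffs_in_cst [simp]: "P \<in> polys I UNIV \<Longrightarrow> coeffs_in I (cst P)"
  by (auto simp: coeffs_in_def cst_def lookup_single when_def polys_def)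

lemma internal_parameters [simp]: "internal I lam" "internal I mu" "internal I TT"
  "internal I X \<Longrightarrow> internal I (- X)"
  "internal I X \<Longrightarrow> internal I Y \<Longrightarrow> internal I (X + Y)"
  "internal I X \<Longrightarrow> internal I Y \<Longrightarrow> internal I (X - Y)"
  by (simp_all add: internal_def)

lemma val2_agree:
  assumes "coeffs_in I P" "agree I t t'"
  shows "val2 y t P = val2 y t' P"
proof -
  have "val t (Poly_Mapping.lookup P k) = val t' (Poly_Mapping.lookup P k)" for k
    using assms by (intro val_agree) (auto simp: coeffs_in_def)
  then show ?thesis by (simp add: val2_expand)
qed

text \<open>The evaluation rule for products, also nested ones: with the index \<open>X\<close> evaluated to \<open>x\<close>, the
  left factor is taken at \<open>T = - x\<close> and the right factor at \<open>T = x + t\<close>.\<close>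

lemma val2_cprod_kernel:
  assumes f: "kernel I f" and B: "represents I B f" and "coeffs_in I P" "coeffs_in I Q"
  shows "val2 (y :: nat + nat \<Rightarrow> complex) t (par_prod B P X Q) =
    f (val2 y (- pt y t X) P) (val2 y (pt y t X + t) Q) (pt y t X) (- pt y t X - t)"
proof -
  have "val2 x t (B (Poly_Mapping.lookup P k) (Poly_Mapping.lookup Q l)) =
      f (val (- x) (Poly_Mapping.lookup P k)) (val (x + t) (Poly_Mapping.lookup Q l)) x (- x - t)" for x k l
    using assms unfolding represents_def coeffs_in_def by blast
  then show ?thesis
    by (simp add: val2_cprod val2_expand[of _ _ P] val2_expand[of _ _ Q] kernel_sum[OF f] kernel_scale[OF f]
        scale_sum_right)
      (subst sum.swap, simp add: mult.commute)
qed

lemma coeffs_in_cprod: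
  assumes f: "kernel I f" and B: "represents I B f" and P: "coeffs_in I P" and Q: "coeffs_in I Q"
    and X: "internal I X"
  shows "coeffs_in I (par_prod B P X Q)"
  unfolding coeffs_in_def
proof (intro allI lookup_in_polysI)
  fix y and t t' :: "nat \<Rightarrow> complex" assume t: "agree I t t'"
  then have *: "agree I (pt y t X) (pt y t' X)"
    using X by (simp add: internal_def)
  have "val2 y (- pt y t X) P = val2 y (- pt y t' X) P" "val2 y (pt y t X + t) Q = val2 y (pt y t' X + t') Q"
    using P Q t * by (auto intro!: val2_agree)
  then show "val2 y t (par_prod B P X Q) = val2 y t' (par_prod B P X Q)"
    using t * by (simp add: val2_cprod_kernel[OF f B P Q] kernel_agree[OF f])
qed

text \<open>Three momenta with \<open>\<lambda> = p\<close>, \<open>\<mu> = q\<close> and \<open>T = - p - q - r\<close> are coordinates on all points, and in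
  identities with three arguments they are the momenta of these arguments.\<close>

lemma par_eq_iff:
  fixes P Q :: "((nat, 'v) mpoly) par"
  shows "P = Q \<longleftrightarrow> (\<forall>p q r. val2 (case_sum p q) (- p - q - r) P = val2 (case_sum p q) (- p - q - r) Q)"
proof
  assume *: "\<forall>p q r. val2 (case_sum p q) (- p - q - r) P = val2 (case_sum p q) (- p - q - r) Q"
  show "P = Q"
  proof (rule val2_eqI)
    fix y :: "nat + nat \<Rightarrow> complex" and t :: "nat \<Rightarrow> complex"
    have "case_sum (y \<circ> Inl) (y \<circ> Inr) = y" by (auto split: sum.split)
    moreover have "- (y \<circ> Inl) - (y \<circ> Inr) - (- (y \<circ> Inl) - (y \<circ> Inr) - t) = t" by simp
    ultimately show "val2 y t P = val2 y t Q" using * by metis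
  qed
qed simp

text \<open>The following are the axioms of superalgebras, with each element carrying a momentum: \<open>a, b, c\<close> carry
  \<open>p, q, r\<close> throughout.\<close>

definition skew :: "'v family \<Rightarrow> bool" where
  "skew f \<longleftrightarrow> (\<forall>\<alpha> \<beta>. \<forall>a\<in>V \<alpha>. \<forall>b\<in>V \<beta>. \<forall>p q. f a b p q = - scale (sg \<alpha> \<beta>) (f b a q p))"

definition jacobi :: "'v family \<Rightarrow> bool" where
  "jacobi f \<longleftrightarrow> (\<forall>\<alpha> \<beta>. \<forall>a\<in>V \<alpha>. \<forall>b\<in>V \<beta>. \<forall>c p q r.
     f a (f b c q r) p (q + r) = f (f a b p q) c (p + q) r + scale (sg \<alpha> \<beta>) (f b (f a c p r) q (p + r)))"

definition left_symmetric :: "'v family \<Rightarrow> bool" where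
  "left_symmetric f \<longleftrightarrow> (\<forall>\<alpha> \<beta> \<gamma>. \<forall>a\<in>V \<alpha>. \<forall>b\<in>V \<beta>. \<forall>c\<in>V \<gamma>. \<forall>p q r.
     f (f a b p q) c (p + q) r - f a (f b c q r) p (q + r) =
     scale (sg \<alpha> \<beta>) (f (f b a q p) c (p + q) r - f b (f a c p r) q (p + r)))"

definition right_commutative :: "'v family \<Rightarrow> bool" where
  "right_commutative f \<longleftrightarrow> (\<forall>\<alpha> \<beta> \<gamma>. \<forall>a\<in>V \<alpha>. \<forall>b\<in>V \<beta>. \<forall>c\<in>V \<gamma>. \<forall>p q r.
     f (f a b p q) c (p + q) r = scale (sg \<beta> \<gamma>) (f (f a c p r) b (p + r) q))"

definition compatible :: "'v family \<Rightarrow> 'v family \<Rightarrow> bool" where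
  "compatible f g \<longleftrightarrow> (\<forall>\<beta> \<gamma>. \<forall>a. \<forall>b\<in>V \<beta>. \<forall>c\<in>V \<gamma>. \<forall>p q r.
     g (f a b p q) c (p + q) r + f (g a b p q) c (p + q) r - f a (g b c q r) p (q + r)
     - scale (sg \<beta> \<gamma>) (g (f a c p r) b (p + r) q) - scale (sg \<beta> \<gamma>) (f (g a c p r) b (p + r) q) = 0)"

lemma cst_in_free_pieces: "a \<in> V \<alpha> \<Longrightarrow> cst a \<in> free_pieces I V \<alpha>"
  by (simp add: free_pieces_def)

text \<open>By sesquilinearity the axioms hold for all module elements once they hold for generators: an
  element \<open>a\<close> with momentum \<open>p\<close> enters only through its value \<open>val (- p) a\<close>, which is an element of \<open>V\<close>
  of the same parity.\<close>

lemma lie_iff: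
  assumes f: "kernel I f" and B: "represents I B f"
    and conf: "conformal_product I (pact scale) (free_pieces I V) B"
  shows "lie_conformal_superalgebra I (pact scale) (free_pieces I V) B \<longleftrightarrow> skew f \<and> jacobi f"
proof -
  note ev = val2_cprod_kernel[OF f B] coeffs_in_cprod[OF f B]
  have skew_val: "par_prod B (cst a) lam (cst b) =
        - par_act (ksign \<alpha> \<beta>) (par_prod B (cst b) (- lam - TT) (cst a)) \<longleftrightarrow>
      (\<forall>p q r. f (val (- p) a) (val (- (q + r)) b) p (q + r) =
        - scale (sg \<alpha> \<beta>) (f (val (- (q + r)) b) (val (- p) a) (q + r) p))"
    if "a \<in> polys I UNIV" "b \<in> polys I UNIV" for a b \<alpha> \<beta>
    using that by (simp add: par_eq_iff ev algebra_simps)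
  have jac_val: "par_prod B (cst a) lam (par_prod B (cst b) mu (cst c)) =
        par_prod B (par_prod B (cst a) lam (cst b)) (lam + mu) (cst c) +
        par_act (ksign \<alpha> \<beta>) (par_prod B (cst b) mu (par_prod B (cst a) lam (cst c))) \<longleftrightarrow>
      (\<forall>p q r. f (val (- p) a) (f (val (- q) b) (val (- r) c) q r) p (q + r) =
         f (f (val (- p) a) (val (- q) b) p q) (val (- r) c) (p + q) r +
         scale (sg \<alpha> \<beta>) (f (val (- q) b) (f (val (- p) a) (val (- r) c) p r) q (p + r)))"
    if "a \<in> polys I UNIV" "b \<in> polys I UNIV" "c \<in> polys I UNIV" for a b c \<alpha> \<beta>
    using that by (simp add: par_eq_iff ev algebra_simps)
  show ?thesis
    unfolding lie_conformal_superalgebra_def total_space_free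
  proof (intro iffI conjI; (elim conjE)?)
    assume *: "\<forall>\<alpha> \<beta>. \<forall>a\<in>free_pieces I V \<alpha>. \<forall>b\<in>free_pieces I V \<beta>.
        par_prod B (cst a) lam (cst b) =
          - par_act (ksign \<alpha> \<beta>) (par_prod B (cst b) (- lam - TT) (cst a))"
    show "skew f"
      unfolding skew_def
    proof (intro allI ballI)
      fix \<alpha> \<beta> a b p q assume "a \<in> V \<alpha>" "b \<in> V \<beta>"
      then have "\<forall>p q r. f a b p (q + r) = - scale (sg \<alpha> \<beta>) (f b a (q + r) p)"
        using * cst_in_free_pieces skew_val[of "cst a" "cst b" \<alpha> \<beta>] by auto
      (* The third momentum is redundant in an identity with two arguments. *)
      from this[rule_format, of p q 0] show "f a b p q = - scale (sg \<alpha> \<beta>) (f b a q p)" by simp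
    qed
  next
    assume *: "\<forall>\<alpha> \<beta>. \<forall>a\<in>free_pieces I V \<alpha>. \<forall>b\<in>free_pieces I V \<beta>. \<forall>c\<in>polys I UNIV.
        par_prod B (cst a) lam (par_prod B (cst b) mu (cst c)) =
        par_prod B (par_prod B (cst a) lam (cst b)) (lam + mu) (cst c) +
        par_act (ksign \<alpha> \<beta>) (par_prod B (cst b) mu (par_prod B (cst a) lam (cst c)))"
    show "jacobi f"
      unfolding jacobi_def
    proof (intro allI ballI)
      fix \<alpha> \<beta> a b c p q r assume "a \<in> V \<alpha>" "b \<in> V \<beta>"
      then show "f a (f b c q r) p (q + r) = f (f a b p q) c (p + q) r + scale (sg \<alpha> \<beta>) (f b (f a c p r) q (p + r))"
        using * cst_in_free_pieces jac_val[of "cst a" "cst b" "cst c" \<alpha> \<beta>] by simp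
    qed
  next
    assume "skew f"
    then show "\<forall>\<alpha> \<beta>. \<forall>a\<in>free_pieces I V \<alpha>. \<forall>b\<in>free_pieces I V \<beta>.
        par_prod B (cst a) lam (cst b) =
          - par_act (ksign \<alpha> \<beta>) (par_prod B (cst b) (- lam - TT) (cst a))"
      using skew_val val_free_pieces free_pieces_subset by (simp add: skew_def)
  next
    assume "jacobi f"
    then show "\<forall>\<alpha> \<beta>. \<forall>a\<in>free_pieces I V \<alpha>. \<forall>b\<in>free_pieces I V \<beta>. \<forall>c\<in>polys I UNIV.
        par_prod B (cst a) lam (par_prod B (cst b) mu (cst c)) =
        par_prod B (par_prod B (cst a) lam (cst b)) (lam + mu) (cst c) +
        par_act (ksign \<alpha> \<beta>) (par_prod B (cst b) mu (par_prod B (cst a) lam (cst c)))"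
      using jac_val val_free_pieces free_pieces_subset by (simp add: jacobi_def)
  qed (rule conf)
qed

lemma novikov_iff:
  assumes f: "kernel I f" and B: "represents I B f"
    and conf: "conformal_product I (pact scale) (free_pieces I V) B"
  shows "novikov_conformal_superalgebra I (pact scale) (free_pieces I V) B \<longleftrightarrow>
    left_symmetric f \<and> right_commutative f"
proof -
  note ev = val2_cprod_kernel[OF f B] coeffs_in_cprod[OF f B]
  let ?ls = "\<lambda>a b c \<alpha> \<beta>. par_prod B (par_prod B (cst a) lam (cst b)) (lam + mu) (cst c) -
          par_prod B (cst a) lam (par_prod B (cst b) mu (cst c)) =
        par_act (ksign \<alpha> \<beta>)
          (par_prod B (par_prod B (cst b) mu (cst a)) (lam + mu) (cst c) -
           par_prod B (cst b) mu (par_prod B (cst a) lam (cst c)))"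
  let ?rc = "\<lambda>a b c \<beta> \<gamma>. par_prod B (par_prod B (cst a) lam (cst b)) (lam + mu) (cst c) =
        par_act (ksign \<beta> \<gamma>)
          (par_prod B (par_prod B (cst a) lam (cst c)) (- mu - TT) (cst b))"
  have ls_val: "?ls a b c \<alpha> \<beta> \<longleftrightarrow>
      (\<forall>p q r. f (f (val (- p) a) (val (- q) b) p q) (val (- r) c) (p + q) r
           - f (val (- p) a) (f (val (- q) b) (val (- r) c) q r) p (q + r) =
         scale (sg \<alpha> \<beta>) (f (f (val (- q) b) (val (- p) a) q p) (val (- r) c) (p + q) r
           - f (val (- q) b) (f (val (- p) a) (val (- r) c) p r) q (p + r)))"
    if "a \<in> polys I UNIV" "b \<in> polys I UNIV" "c \<in> polys I UNIV" for a b c \<alpha> \<beta>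
    using that by (simp add: par_eq_iff ev algebra_simps)
  have rc_val: "?rc a b c \<beta> \<gamma> \<longleftrightarrow>
      (\<forall>p q r. f (f (val (- p) a) (val (- q) b) p q) (val (- r) c) (p + q) r =
         scale (sg \<beta> \<gamma>) (f (f (val (- p) a) (val (- r) c) p r) (val (- q) b) (p + r) q))"
    if "a \<in> polys I UNIV" "b \<in> polys I UNIV" "c \<in> polys I UNIV" for a b c \<beta> \<gamma>
    using that by (simp add: par_eq_iff ev algebra_simps)
  show ?thesis
    unfolding novikov_conformal_superalgebra_def
  proof (intro iffI conjI; (elim conjE)?)
    assume *: "\<forall>\<alpha> \<beta> \<gamma>. \<forall>a\<in>free_pieces I V \<alpha>. \<forall>b\<in>free_pieces I V \<beta>. \<forall>c\<in>free_pieces I V \<gamma>. ?ls a b c \<alpha> \<beta>"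
    show "left_symmetric f"
      unfolding left_symmetric_def
    proof (intro allI ballI)
      fix \<alpha> \<beta> \<gamma> a b c p q r assume "a \<in> V \<alpha>" "b \<in> V \<beta>" "c \<in> V \<gamma>"
      then show "f (f a b p q) c (p + q) r - f a (f b c q r) p (q + r) =
          scale (sg \<alpha> \<beta>) (f (f b a q p) c (p + q) r - f b (f a c p r) q (p + r))"
        using *[rule_format, OF cst_in_free_pieces cst_in_free_pieces cst_in_free_pieces] ls_val[of "cst a" "cst b" "cst c" \<alpha> \<beta>] by simp
    qed
  next
    assume *: "\<forall>\<alpha> \<beta> \<gamma>. \<forall>a\<in>free_pieces I V \<alpha>. \<forall>b\<in>free_pieces I V \<beta>. \<forall>c\<in>free_pieces I V \<gamma>. ?rc a b c \<beta> \<gamma>"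
    show "right_commutative f"
      unfolding right_commutative_def
    proof (intro allI ballI)
      fix \<alpha> \<beta> \<gamma> a b c p q r assume "a \<in> V \<alpha>" "b \<in> V \<beta>" "c \<in> V \<gamma>"
      then show "f (f a b p q) c (p + q) r = scale (sg \<beta> \<gamma>) (f (f a c p r) b (p + r) q)"
        using *[rule_format, OF cst_in_free_pieces cst_in_free_pieces cst_in_free_pieces] rc_val[of "cst a" "cst b" "cst c" \<beta> \<gamma>] by simp
    qed
  next
    assume "left_symmetric f"
    then show "\<forall>\<alpha> \<beta> \<gamma>. \<forall>a\<in>free_pieces I V \<alpha>. \<forall>b\<in>free_pieces I V \<beta>. \<forall>c\<in>free_pieces I V \<gamma>. ?ls a b c \<alpha> \<beta>"
    proof (intro allI ballI)
      fix \<alpha> \<beta> \<gamma> a b c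
      assume abc: "a \<in> free_pieces I V \<alpha>" "b \<in> free_pieces I V \<beta>" "c \<in> free_pieces I V \<gamma>"
      note vals = abc[THEN val_free_pieces]
      show "?ls a b c \<alpha> \<beta>"
        unfolding ls_val[OF abc[THEN free_pieces_subset]]
        using \<open>left_symmetric f\<close>[unfolded left_symmetric_def, rule_format, OF vals] by blast
    qed
  next
    assume "right_commutative f"
    then show "\<forall>\<alpha> \<beta> \<gamma>. \<forall>a\<in>free_pieces I V \<alpha>. \<forall>b\<in>free_pieces I V \<beta>. \<forall>c\<in>free_pieces I V \<gamma>. ?rc a b c \<beta> \<gamma>"
    proof (intro allI ballI)
      fix \<alpha> \<beta> \<gamma> a b c
      assume abc: "a \<in> free_pieces I V \<alpha>" "b \<in> free_pieces I V \<beta>" "c \<in> free_pieces I V \<gamma>"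
      note vals = abc[THEN val_free_pieces]
      show "?rc a b c \<beta> \<gamma>"
        unfolding rc_val[OF abc[THEN free_pieces_subset]]
        using \<open>right_commutative f\<close>[unfolded right_commutative_def, rule_format, OF vals] by blast
    qed
  qed (rule conf)
qed

text \<open>Here \<open>\<lambda>\<close> is the momentum of \<open>c\<close> and \<open>\<mu>\<close> that of \<open>b\<close>. The three substituted tuples \<open>- \<mu> - T\<close>,
  \<open>- \<lambda> - T\<close> and \<open>- \<lambda> - \<mu> - T\<close> are then the momenta of whatever stands on the left of the respective
  product.\<close>

lemma compatible_iff:
  assumes f: "kernel I f" and N: "represents I N f" and g: "kernel I g" and K: "represents I K g"
  shows "gelfand_dorfman_compatible scale V N K \<longleftrightarrow> compatible f g"
proof -
  note ev = val2_cprod_kernel[OF f N] coeffs_in_cprod[OF f N] val2_cprod_kernel[OF g K] coeffs_in_cprod[OF g K]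
  have *: "par_prod K (par_prod N (cst (cst a)) (- mu - TT) (cst (cst b))) (- lam - TT) (cst (cst c))
        + par_prod N (par_prod K (cst (cst a)) (- mu - TT) (cst (cst b))) (- lam - TT) (cst (cst c))
        - par_prod N (cst (cst a)) (- lam - mu - TT) (par_prod K (cst (cst b)) (- lam - TT) (cst (cst c)))
        - par_act (ksign \<beta> \<gamma>) (par_prod K (par_prod N (cst (cst a)) (- lam - TT) (cst (cst c))) (- mu - TT) (cst (cst b)))
        - par_act (ksign \<beta> \<gamma>) (par_prod N (par_prod K (cst (cst a)) (- lam - TT) (cst (cst c))) (- mu - TT) (cst (cst b)))
        = 0 \<longleftrightarrow> (\<forall>p q r.
      g (f a b r q) c (r + q) p + f (g a b r q) c (r + q) p - f a (g b c q p) r (q + p)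
     - scale (sg \<beta> \<gamma>) (g (f a c r p) b (r + p) q) - scale (sg \<beta> \<gamma>) (f (g a c r p) b (r + p) q) = 0)" for a b c \<beta> \<gamma>
    by (simp add: par_eq_iff ev algebra_simps)
  show ?thesis
    unfolding gelfand_dorfman_compatible_def compatible_def Let_def * total by blast
qed

end

section \<open>Signs and quadratic polynomials\<close>

lemma sg_cases: "sg \<alpha> \<beta> = 1 \<or> sg \<alpha> \<beta> = - 1"
  by (simp add: sg_def)

lemma sg_add [simp]: "sg (\<alpha> + \<beta>) \<gamma> = sg \<alpha> \<gamma> * sg \<beta> \<gamma>" "sg \<alpha> (\<beta> + \<gamma>) = sg \<alpha> \<beta> * sg \<alpha> \<gamma>"
  by (cases \<alpha>; cases \<beta>; cases \<gamma>; simp add: sg_def add_bit_eq_xor)+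

lemma sg_commute: "sg \<alpha> \<beta> = sg \<beta> \<alpha>"
  by (simp add: sg_def mult.commute)

(* Sums of parities are kept as they are, for the sake of kernel_graded and sg_add. *)
declare add_bit_eq_xor [simp del]

text \<open>One coefficient of each kind (square, mixed product, linear, constant) is enough, as the other
  coefficients of the Jacobi identity arise from these by permuting the three arguments.\<close>

lemma (in complex_space) quadratic_eq_0D:
  assumes *: "\<And>x y z. scale (x * x) e1 + scale (y * y) e2 + scale (z * z) e3 + scale (x * y) e4 + scale (x * z) e5
      + scale (y * z) e6 + scale x e7 + scale y e8 + scale z e9 + e10 = 0"
  shows "e1 = 0" "e4 = 0" "e7 = 0" "e10 = 0"
proof -
  have pm: "u = 0" "w = 0" if "u + w = 0" "u - w = 0" for u w :: 'v
  proof -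
    have "scale 2 u = scale (1 + 1) u" by (simp only: one_add_one)
    also have "\<dots> = (u + w) + (u - w)" by (simp only: scale_left_distrib scale_one) simp
    finally have "scale 2 u = (u + w) + (u - w)" .
    then show "u = 0" using that by simp
    then show "w = 0" using that by simp
  qed
  show 10: "e10 = 0" using *[of 0 0 0] by simp
  have "e1 + e7 = 0" "e1 - e7 = 0"
    using *[of 1 0 0] *[of "-1" 0 0] 10 by simp_all
  note 1 = pm[OF this]
  have "e2 + e8 = 0" "e2 - e8 = 0"
    using *[of 0 1 0] *[of 0 "-1" 0] 10 by simp_all
  note 2 = pm[OF this]
  show "e1 = 0" "e7 = 0" by (fact 1)+
  show "e4 = 0" using *[of 1 1 0] 1 2 10 by simp
qed

context graded_space begin

section \<open>The Gel'fand-Dorfman bracket\<close>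

definition odd_part :: "'v \<Rightarrow> 'v" where
  "odd_part a = (THE w. w \<in> V 1 \<and> a - w \<in> V 0)"

lemma odd_part_eqI:
  assumes "w \<in> V 1" "a - w \<in> V 0"
  shows "odd_part a = w"
  unfolding odd_part_def
proof (rule the_equality)
  fix w' assume w': "w' \<in> V 1 \<and> a - w' \<in> V 0"
  have "w - w' \<in> V 1" using assms w' by (simp add: subspace_diff[OF subspace_V])
  moreover have "(a - w') - (a - w) \<in> V 0" by (rule subspace_diff[OF subspace_V]) (use assms w' in simp_all)
  ultimately show "w' = w" using V_disjoint[of "w - w'"] by simp
qed (use assms in simp)

lemma odd_part: "odd_part a \<in> V 1" "a - odd_part a \<in> V 0"
proof -
  obtain u w where "u \<in> V 0" "w \<in> V 1" "a = u + w" by (rule V_cases)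
  then show "odd_part a \<in> V 1" "a - odd_part a \<in> V 0"
    using odd_part_eqI[of w a] by auto
qed

lemma odd_part_add: "odd_part (a + b) = odd_part a + odd_part b"
proof (rule odd_part_eqI)
  show "odd_part a + odd_part b \<in> V 1"
    by (intro subspace_add subspace_V odd_part)
  have "(a - odd_part a) + (b - odd_part b) \<in> V 0"
    by (intro subspace_add subspace_V odd_part)
  then show "a + b - (odd_part a + odd_part b) \<in> V 0"
    by (simp add: algebra_simps)
qed

lemma odd_part_scale: "odd_part (scale z a) = scale z (odd_part a)"
proof (rule odd_part_eqI)
  show "scale z (odd_part a) \<in> V 1"
    by (intro subspace_scale subspace_V odd_part)
  show "scale z a - scale z (odd_part a) \<in> V 0"
    using subspace_scale[OF subspace_V odd_part(2)] by (simp add: scale_right_diff_distrib)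
qed

lemma odd_part_even [simp]: "a \<in> V 0 \<Longrightarrow> odd_part a = 0"
  by (rule odd_part_eqI) (simp_all add: subspace_0 subspace_V)

lemma odd_part_odd [simp]: "a \<in> V 1 \<Longrightarrow> odd_part a = a"
  by (rule odd_part_eqI) (simp_all add: subspace_0 subspace_V)

text \<open>The opposite product \<open>(-1)^(\<alpha>\<beta>) b \<circ> a\<close>, extended bilinearly to elements that are not
  homogeneous: the sign differs from \<open>1\<close> only on the odd parts.\<close>

definition opp :: "'v family \<Rightarrow> 'v family" where
  "opp f a b p q = f b a q p - scale 2 (f (odd_part b) (odd_part a) q p)"

text \<open>The Gel'fand-Dorfman bracket. With \<open>p = \<lambda>\<close> and \<open>q = - \<lambda> - T\<close>, so that \<open>- q\<^sub>i = T\<^sub>i + \<lambda>\<^sub>i\<close>, it is the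
  bracket formula of the theorem.\<close>

definition gd_bracket :: "nat \<Rightarrow> 'v family \<Rightarrow> 'v family \<Rightarrow> 'v family" where
  "gd_bracket i f g a b p q = scale (p i) (f a b p q) - scale (q i) (opp f a b p q) + g a b p q"

lemma bit_cases: "\<alpha> = 0 \<or> \<alpha> = (1 :: bit)"
  by (cases \<alpha>) auto

lemma opp_homogeneous:
  assumes f: "kernel J f" and a: "a \<in> V \<alpha>" and b: "b \<in> V \<beta>"
  shows "opp f a b p q = scale (sg \<alpha> \<beta>) (f b a q p)"
proof -
  have "u - scale 2 u = - u" for u
    using scale_left_diff_distrib[of 1 2 u] by simp
  then show ?thesis
    using a b bit_cases[of \<alpha>] bit_cases[of \<beta>] by (auto simp: opp_def sg_def kernel_0[OF f])
qed

lemma kernelI: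
  assumes "\<And>a a' b p q. f (a + a') b p q = f a b p q + f a' b p q"
    and "\<And>a a' b p q. f b (a + a') p q = f b a p q + f b a' p q"
    and "\<And>z a b p q. f (scale z a) b p q = scale z (f a b p q)"
    and "\<And>z a b p q. f a (scale z b) p q = scale z (f a b p q)"
    and "\<And>\<alpha> \<beta> a b p q. a \<in> V \<alpha> \<Longrightarrow> b \<in> V \<beta> \<Longrightarrow> f a b p q \<in> V (\<alpha> + \<beta>)"
    and "\<And>a b. f a b \<in> pfuns I"
  shows "kernel I f"
  unfolding kernel_def by (intro conjI allI ballI assms)

lemma kernel_opp:
  assumes f: "kernel J f"
  shows "kernel J (opp f)"
proof (rule kernelI)
  show "opp f a b p q \<in> V (\<alpha> + \<beta>)" if "a \<in> V \<alpha>" "b \<in> V \<beta>" for \<alpha> \<beta> a b p q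
    using subspace_scale[OF subspace_V kernel_graded[OF f that(2,1)]]
    by (simp add: opp_homogeneous[OF f that] add.commute)
  show "opp f a b \<in> pfuns J" for a b
    unfolding opp_def[abs_def]
    by (rule pfuns_diff[OF pfuns_swap[OF kernel_pfuns[OF f]] pfuns_scale[OF pfuns_swap[OF kernel_pfuns[OF f]]]])
qed (simp_all add: opp_def kernel_add[OF f] kernel_scale[OF f] odd_part_add odd_part_scale algebra_simps)

lemma kernel_gd_bracket:
  assumes f: "kernel J f" and g: "kernel J g" and "J \<subseteq> I" "i \<in> I"
  shows "kernel I (gd_bracket i f g)"
proof (rule kernelI)
  note o = kernel_opp[OF f]
  show "gd_bracket i f g a b p q \<in> V (\<alpha> + \<beta>)" if "a \<in> V \<alpha>" "b \<in> V \<beta>" for \<alpha> \<beta> a b p q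
    unfolding gd_bracket_def using that
    by (intro subspace_add subspace_diff subspace_scale subspace_V kernel_graded[OF f] kernel_graded[OF g] kernel_graded[OF o])
  show "gd_bracket i f g a b \<in> pfuns I" for a b
    unfolding gd_bracket_def[abs_def] using assms
    by (intro pfuns.add pfuns_diff pfuns.fst pfuns.snd)
      (auto intro: pfuns_mono kernel_pfuns[OF f] kernel_pfuns[OF g] kernel_pfuns[OF o])
qed (simp_all add: gd_bracket_def kernel_add[OF f] kernel_scale[OF f] kernel_add[OF g] kernel_scale[OF g]
    kernel_add[OF kernel_opp[OF f]] kernel_scale[OF kernel_opp[OF f]] algebra_simps)

lemma kernel_eqI:
  assumes f: "kernel I f" and g: "kernel I g"
    and eq: "\<And>\<alpha> \<beta> a b p q. a \<in> V \<alpha> \<Longrightarrow> b \<in> V \<beta> \<Longrightarrow> f a b p q = g a b p q"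
  shows "f = g"
proof (intro ext)
  fix a b p q
  obtain u w where a: "u \<in> V 0" "w \<in> V 1" "a = u + w" by (rule V_cases)
  obtain u' w' where b: "u' \<in> V 0" "w' \<in> V 1" "b = u' + w'" by (rule V_cases)
  show "f a b p q = g a b p q"
    using eq[OF a(1) b(1)] eq[OF a(1) b(2)] eq[OF a(2) b(1)] eq[OF a(2) b(2)] a(3) b(3)
    by (simp add: kernel_add[OF f] kernel_add[OF g])
qed

lemma agree_upd: "i \<notin> J \<Longrightarrow> agree J (p(i := x)) p" 
  by (auto simp: agree_def)

lemma agree_upd_add: "i \<notin> J \<Longrightarrow> agree J (p(i := x) + q(i := y)) (p + q)"
  by (auto simp: agree_def)

text \<open>Changing the \<open>i\<close>-th coordinates of the momenta does not affect kernels in variables other than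
  the \<open>i\<close>-th. So these coordinates are free parameters in every identity between such kernels.\<close>

lemma kernel_upd:
  assumes "kernel J f" "i \<notin> J"
  shows "f a b (p(i := x)) (q(i := y)) = f a b p q"
    "f a b (p(i := x)) (q(i := y) + r(i := z)) = f a b p (q + r)"
    "f a b (p(i := x) + q(i := y)) (r(i := z)) = f a b (p + q) r"
  using assms by (auto intro!: kernel_agree agree_upd agree_upd_add)

lemma gd_homogeneous:
  assumes "kernel J f" "a \<in> V \<alpha>" "b \<in> V \<beta>"
  shows "gd_bracket i f g a b p q = scale (p i) (f a b p q) - scale (q i * sg \<alpha> \<beta>) (f b a q p) + g a b p q"
  using opp_homogeneous[OF assms] by (simp add: gd_bracket_def)

text \<open>Exchanging the arguments of \<open>gd_bracket\<close> exchanges its first two terms up to the sign, so only the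
  last term matters.\<close>

lemma skew_gd_iff:
  assumes f: "kernel J f" and g: "kernel J g" and i: "i \<notin> J"
  shows "skew (gd_bracket i f g) \<longleftrightarrow> skew g"
proof
  assume *: "skew (gd_bracket i f g)"
  show "skew g"
    unfolding skew_def
  proof (intro allI ballI)
    fix \<alpha> \<beta> a b p q assume "a \<in> V \<alpha>" "b \<in> V \<beta>"
    with * have "gd_bracket i f g a b (p(i := 0)) (q(i := 0)) = - scale (sg \<alpha> \<beta>) (gd_bracket i f g b a (q(i := 0)) (p(i := 0)))"
      unfolding skew_def by blast
    then show "g a b p q = - scale (sg \<alpha> \<beta>) (g b a q p)"
      by (simp add: gd_bracket_def kernel_upd[OF g i])
  qed
next
  assume *: "skew g"
  show "skew (gd_bracket i f g)"
    unfolding skew_def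
  proof (intro allI ballI)
    fix \<alpha> \<beta> a b p q assume ab: "a \<in> V \<alpha>" "b \<in> V \<beta>"
    with * have g': "g a b p q = - scale (sg \<alpha> \<beta>) (g b a q p)"
      unfolding skew_def by blast
    show "gd_bracket i f g a b p q = - scale (sg \<alpha> \<beta>) (gd_bracket i f g b a q p)"
      unfolding gd_homogeneous[OF f ab] gd_homogeneous[OF f ab(2,1)] g' sg_commute[of \<beta> \<alpha>]
      using sg_cases[of \<alpha> \<beta>] by (auto simp: algebra_simps)
  qed
qed

text \<open>The failure of right commutativity, left symmetry, compatibility and the Jacobi identity, with \<open>s\<close> the
  sign of the transposition that occurs in the identity.\<close>

definition rc_defect :: "'v family \<Rightarrow> complex \<Rightarrow> 'v \<Rightarrow> 'v \<Rightarrow> 'v \<Rightarrow> momentum \<Rightarrow> momentum \<Rightarrow> momentum \<Rightarrow> 'v"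
  where
  "rc_defect f s a b c p q r = f (f a b p q) c (p + q) r - scale s (f (f a c p r) b (p + r) q)"

definition ls_defect :: "'v family \<Rightarrow> complex \<Rightarrow> 'v \<Rightarrow> 'v \<Rightarrow> 'v \<Rightarrow> momentum \<Rightarrow> momentum \<Rightarrow> momentum \<Rightarrow> 'v"
  where
  "ls_defect f s a b c p q r = f (f a b p q) c (p + q) r - f a (f b c q r) p (q + r)
     - scale s (f (f b a q p) c (q + p) r - f b (f a c p r) q (p + r))"

definition gd_defect ::
  "'v family \<Rightarrow> 'v family \<Rightarrow> complex \<Rightarrow> 'v \<Rightarrow> 'v \<Rightarrow> 'v \<Rightarrow> momentum \<Rightarrow> momentum \<Rightarrow> momentum \<Rightarrow> 'v" where
  "gd_defect f g s a b c p q r =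
     g (f a b p q) c (p + q) r + f (g a b p q) c (p + q) r - f a (g b c q r) p (q + r)
     - scale s (g (f a c p r) b (p + r) q) - scale s (f (g a c p r) b (p + r) q)"

definition jacobi_defect :: "'v family \<Rightarrow> complex \<Rightarrow> 'v \<Rightarrow> 'v \<Rightarrow> 'v \<Rightarrow> momentum \<Rightarrow> momentum \<Rightarrow> momentum \<Rightarrow> 'v"
  where
  "jacobi_defect f s a b c p q r =
     f a (f b c q r) p (q + r) - (f (f a b p q) c (p + q) r + scale s (f b (f a c p r) q (p + r)))"

text \<open>The heart of the proof. Expand the three double brackets, which are products of two linear forms in
  \<open>x, y, z\<close>, and collect coefficients. The Jacobi defect of a skew bracket is symmetric up to sign in
  its three arguments, and the coefficients are permuted accordingly: those of
  \<open>x\<^sup>2, y\<^sup>2, z\<^sup>2\<close> are the three versions of one identity, and likewise for \<open>x y, x z, y z\<close> and for \<open>x, y, z\<close>.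
  Skew symmetry of \<open>g\<close> is what brings the linear coefficients into this form.\<close>

lemma jacobi_defect_gd_bracket:
  fixes p q r :: "nat \<Rightarrow> complex" and i :: nat
  assumes f: "kernel J f" and g: "kernel J g" and sk: "skew g"
    and abc: "a \<in> V \<alpha>" "b \<in> V \<beta>" "c \<in> V \<gamma>"
  defines "L \<equiv> gd_bracket i f g" and "s \<equiv> sg \<alpha> \<beta>" and "u \<equiv> sg \<alpha> \<gamma>" and "v \<equiv> sg \<beta> \<gamma>"
    and "x \<equiv> p i" and "y \<equiv> q i" and "z \<equiv> r i"
  shows "jacobi_defect L s a b c p q r =
      scale (x * x) (- rc_defect f v a b c p q r)
    + scale (y * y) (scale s (rc_defect f u b a c q p r))
    + scale (z * z) (- scale (u * v) (rc_defect f s c a b r p q))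
    + scale (x * y) (- ls_defect f s a b c p q r)
    + scale (x * z) (scale v (ls_defect f u a c b p r q))
    + scale (y * z) (- scale (s * u) (ls_defect f v b c a q r p))
    + scale x (- gd_defect f g v a b c p q r)
    + scale y (scale s (gd_defect f g u b a c q p r))
    + scale z (- scale (u * v) (gd_defect f g s c a b r p q))
    + jacobi_defect g s a b c p q r"
proof -
  have L: "kernel (insert i J) L"
    unfolding L_def by (rule kernel_gd_bracket[OF f g]) auto
  note grs = kernel_graded[OF L]
  note hom = gd_homogeneous[OF f, of _ _ _ _ i g, folded L_def]
  (* Outer brackets first: the inner ones are homogeneous of the sum of the parities. *)
  have 1: "L a (L b c q r) p (q + r) = scale x (f a (L b c q r) p (q + r))
      - scale ((y + z) * (s * u)) (f (L b c q r) a (q + r) p) + g a (L b c q r) p (q + r)"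
    using hom[OF abc(1) grs[OF abc(2,3)]] by (simp add: x_def y_def z_def s_def u_def)
  have 2: "L (L a b p q) c (p + q) r = scale (x + y) (f (L a b p q) c (p + q) r)
      - scale (z * (u * v)) (f c (L a b p q) r (p + q)) + g (L a b p q) c (p + q) r"
    using hom[OF grs[OF abc(1,2)] abc(3)] by (simp add: x_def y_def z_def u_def v_def)
  have 3: "L b (L a c p r) q (p + r) = scale y (f b (L a c p r) q (p + r))
      - scale ((x + z) * (s * v)) (f (L a c p r) b (p + r) q) + g b (L a c p r) q (p + r)"
    using hom[OF abc(2) grs[OF abc(1,3)]] sg_commute[of \<beta> \<alpha>] by (simp add: x_def y_def z_def s_def v_def)
  note inner = hom[OF abc(2,3), of q r] hom[OF abc(1,2), of p q] hom[OF abc(1,3), of p r]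
  have skew: "g a b p q = - scale (sg \<alpha> \<beta>) (g b a q p)" if "a \<in> V \<alpha>" "b \<in> V \<beta>" for \<alpha> \<beta> a b p q
    using sk that unfolding skew_def by blast
  have swap: "g a (f b c q r) p (q + r) = - scale (s * u) (g (f b c q r) a (q + r) p)"
    "g a (f c b r q) p (q + r) = - scale (s * u) (g (f c b r q) a (q + r) p)"
    "g b (f a c p r) q (p + r) = - scale (s * v) (g (f a c p r) b (p + r) q)"
    "g b (f c a r p) q (p + r) = - scale (s * v) (g (f c a r p) b (p + r) q)"
    "g b a q p = - scale s (g a b p q)" "g c a r p = - scale u (g a c p r)" "g c b r q = - scale v (g b c q r)"
    using skew[OF abc(1) kernel_graded[OF f abc(2,3)]] skew[OF abc(1) kernel_graded[OF f abc(3,2)]]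
      skew[OF abc(2) kernel_graded[OF f abc(1,3)]] skew[OF abc(2) kernel_graded[OF f abc(3,1)]]
      skew[OF abc(2,1)] skew[OF abc(3,1)] skew[OF abc(3,2)]
    by (simp_all only: sg_add s_def u_def v_def sg_commute[of \<beta> \<alpha>] sg_commute[of \<gamma> \<alpha>] sg_commute[of \<gamma> \<beta>] mult.commute)
  have signs: "s = 1 \<or> s = - 1" "u = 1 \<or> u = - 1" "v = 1 \<or> v = - 1"
    unfolding s_def u_def v_def by (rule sg_cases)+
  have sums: "q + p = p + q" "r + p = p + r" "r + q = q + r"
    by (simp_all add: add.commute)
  show ?thesis
    unfolding jacobi_defect_def 1 2 3
    unfolding inner rc_defect_def ls_defect_def gd_defect_def sums
    unfolding s_def[symmetric] u_def[symmetric] v_def[symmetric] x_def[symmetric] y_def[symmetric] z_def[symmetric]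
      kernel_add[OF f] kernel_add[OF g] kernel_diff[OF f] kernel_diff[OF g] kernel_scale[OF f] kernel_scale[OF g]
    unfolding swap kernel_minus[OF f] kernel_scale[OF f]
    using signs by (elim disjE; simp add: algebra_simps)
qed


section \<open>The Jacobi identity of the Gel'fand-Dorfman bracket\<close>

lemma jacobi_homogeneousI:
  assumes h: "kernel H h" and hom: "\<And>\<alpha> \<beta> \<gamma> a b c p q r. a \<in> V \<alpha> \<Longrightarrow> b \<in> V \<beta> \<Longrightarrow> c \<in> V \<gamma> \<Longrightarrow>
      jacobi_defect h (sg \<alpha> \<beta>) a b c p q r = 0"
  shows "jacobi h"
  unfolding jacobi_def
proof (intro allI ballI)
  fix \<alpha> \<beta> a b c p q r assume ab: "a \<in> V \<alpha>" "b \<in> V \<beta>"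
  obtain u w where c: "u \<in> V 0" "w \<in> V 1" "c = u + w" by (rule V_cases)
  show "h a (h b c q r) p (q + r) = h (h a b p q) c (p + q) r + scale (sg \<alpha> \<beta>) (h b (h a c p r) q (p + r))"
    using hom[OF ab c(1), of p q r] hom[OF ab c(2), of p q r]
    by (simp add: jacobi_defect_def c(3) kernel_add[OF h] scale_right_distrib)
qed

lemma compatible_homogeneousI:
  assumes f: "kernel J f" and g: "kernel J g" and hom: "\<And>\<alpha> \<beta> \<gamma> a b c p q r. a \<in> V \<alpha> \<Longrightarrow> b \<in> V \<beta> \<Longrightarrow> c \<in> V \<gamma> \<Longrightarrow>
      gd_defect f g (sg \<beta> \<gamma>) a b c p q r = 0"
  shows "compatible f g"
  unfolding compatible_def gd_defect_def[symmetric]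
proof (intro allI ballI)
  fix \<beta> \<gamma> a b c p q r assume bc: "b \<in> V \<beta>" "c \<in> V \<gamma>"
  obtain u w where a: "u \<in> V 0" "w \<in> V 1" "a = u + w" by (rule V_cases)
  have "gd_defect f g (sg \<beta> \<gamma>) a b c p q r = gd_defect f g (sg \<beta> \<gamma>) u b c p q r + gd_defect f g (sg \<beta> \<gamma>) w b c p q r"
    unfolding gd_defect_def a(3) kernel_add[OF f] kernel_add[OF g] scale_right_distrib by (simp add: algebra_simps)
  then show "gd_defect f g (sg \<beta> \<gamma>) a b c p q r = 0"
    using hom[OF a(1) bc] hom[OF a(2) bc] by simp
qed

lemma right_commutative_defect: "right_commutative f \<longleftrightarrow>
    (\<forall>\<alpha> \<beta> \<gamma>. \<forall>a\<in>V \<alpha>. \<forall>b\<in>V \<beta>. \<forall>c\<in>V \<gamma>. \<forall>p q r. rc_defect f (sg \<beta> \<gamma>) a b c p q r = 0)"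
  by (simp add: right_commutative_def rc_defect_def)

lemma left_symmetric_defect: "left_symmetric f \<longleftrightarrow>
    (\<forall>\<alpha> \<beta> \<gamma>. \<forall>a\<in>V \<alpha>. \<forall>b\<in>V \<beta>. \<forall>c\<in>V \<gamma>. \<forall>p q r. ls_defect f (sg \<alpha> \<beta>) a b c p q r = 0)"
proof -
  have "ls_defect f s a b c p q r = f (f a b p q) c (p + q) r - f a (f b c q r) p (q + r)
     - scale s (f (f b a q p) c (p + q) r - f b (f a c p r) q (p + r))"
    for s a b c p q r
    by (simp only: ls_defect_def add.commute[of q p])
  then show ?thesis
    unfolding left_symmetric_def by simp
qed

text \<open>Replacing \<open>p\<^sub>i, q\<^sub>i, r\<^sub>i\<close> by arbitrary numbers leaves the coefficients in
  \<open>jacobi_defect_gd_bracket\<close> unchanged, so the Jacobi identity holds if and only if they all vanish.\<close>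

lemma gd_jacobi_iff:
  assumes f: "kernel J f" and g: "kernel J g" and i: "i \<notin> J" and sk: "skew g"
  shows "jacobi (gd_bracket i f g) \<longleftrightarrow>
    left_symmetric f \<and> right_commutative f \<and> compatible f g \<and> jacobi g"
proof
  let ?L = "gd_bracket i f g"
  note defect = jacobi_defect_gd_bracket[OF f g sk, of _ _ _ _ _ _ i]
  show "left_symmetric f \<and> right_commutative f \<and> compatible f g \<and> jacobi g" if jac: "jacobi ?L"
  proof -
    have coeffs: "rc_defect f (sg \<beta> \<gamma>) a b c p q r = 0 \<and> ls_defect f (sg \<alpha> \<beta>) a b c p q r = 0 \<and>
        gd_defect f g (sg \<beta> \<gamma>) a b c p q r = 0 \<and> jacobi_defect g (sg \<alpha> \<beta>) a b c p q r = 0"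
      if abc: "a \<in> V \<alpha>" "b \<in> V \<beta>" "c \<in> V \<gamma>" for \<alpha> \<beta> \<gamma> a b c p q r
    proof -
      have "jacobi_defect ?L (sg \<alpha> \<beta>) a b c p q r = 0" for p q r
        unfolding jacobi_defect_def right_minus_eq
        by (rule jac[unfolded jacobi_def, rule_format, OF abc(1,2)])
      note * = this[unfolded defect[OF abc]]
      have upd:
        "rc_defect f s a b c (p(i := x)) (q(i := y)) (r(i := z)) = rc_defect f s a b c p q r"
        "ls_defect f s a b c (p(i := x)) (q(i := y)) (r(i := z)) = ls_defect f s a b c p q r"
        "gd_defect f g s a b c (p(i := x)) (q(i := y)) (r(i := z)) = gd_defect f g s a b c p q r"
        "jacobi_defect g s a b c (p(i := x)) (q(i := y)) (r(i := z)) = jacobi_defect g s a b c p q r"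
        for s a b c p q r x y z
        unfolding rc_defect_def ls_defect_def gd_defect_def jacobi_defect_def kernel_upd[OF f i] kernel_upd[OF g i]
        by (rule refl)+
      show ?thesis
        using quadratic_eq_0D[OF *[of "p(i := x)" "q(i := y)" "r(i := z)" for x y z, unfolded upd fun_upd_same]]
        by (simp only: neg_equal_0_iff_equal)
    qed
    then show ?thesis
      unfolding left_symmetric_defect right_commutative_defect
      using compatible_homogeneousI[OF f g] jacobi_homogeneousI[OF g] by blast
  qed
  show "jacobi ?L" if *: "left_symmetric f \<and> right_commutative f \<and> compatible f g \<and> jacobi g"
  proof (rule jacobi_homogeneousI)
    have ls: "left_symmetric f" and rc: "right_commutative f" and comp: "compatible f g" and jac: "jacobi g"
      using * by simp_all
    show "kernel (insert i J) ?L"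
      by (rule kernel_gd_bracket[OF f g]) auto
    have 0: "rc_defect f (sg \<beta> \<gamma>) a b c p q r = 0" "ls_defect f (sg \<alpha> \<beta>) a b c p q r = 0"
      "gd_defect f g (sg \<beta> \<gamma>) a b c p q r = 0" "jacobi_defect g (sg \<alpha> \<beta>) a b c p q r = 0"
      if abc: "a \<in> V \<alpha>" "b \<in> V \<beta>" "c \<in> V \<gamma>" for \<alpha> \<beta> \<gamma> a b c p q r
    proof -
      show "rc_defect f (sg \<beta> \<gamma>) a b c p q r = 0"
        by (rule rc[unfolded right_commutative_defect, rule_format, OF abc])
      show "ls_defect f (sg \<alpha> \<beta>) a b c p q r = 0"
        by (rule ls[unfolded left_symmetric_defect, rule_format, OF abc])
      show "gd_defect f g (sg \<beta> \<gamma>) a b c p q r = 0"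
        unfolding gd_defect_def by (rule comp[unfolded compatible_def, rule_format, OF abc(2,3)])
      show "jacobi_defect g (sg \<alpha> \<beta>) a b c p q r = 0"
        unfolding jacobi_defect_def right_minus_eq by (rule jac[unfolded jacobi_def, rule_format, OF abc(1,2)])
    qed
    fix \<alpha> \<beta> \<gamma> a b c p q r assume abc: "a \<in> V \<alpha>" "b \<in> V \<beta>" "c \<in> V \<gamma>"
    show "jacobi_defect ?L (sg \<alpha> \<beta>) a b c p q r = 0"
      unfolding defect[OF abc] 0(4)[OF abc]
      using 0(1-3)[OF abc] 0(1,3)[OF abc(2,1,3)] 0(1,3)[OF abc(3,1,2)] 0(2)[OF abc(1,3,2)] 0(2)[OF abc(2,3,1)]
      by simp
  qed
qed

section \<open>Linear brackets and the correspondence\<close>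

text \<open>The coordinates \<open>(x, t) = (\<lambda>, T)\<close> are those in which \<open>i\<close>-linearity is phrased.\<close>

definition linear_kernel :: "nat \<Rightarrow> nat set \<Rightarrow> 'v family \<Rightarrow> bool" where
  "linear_kernel i J f \<longleftrightarrow> (\<forall>a b. \<exists>F\<in>pfuns J. \<exists>G\<in>pfuns J. \<exists>H\<in>pfuns J. \<forall>x t.
     f a b x (- x - t) = scale (t i) (F x t) + scale (x i) (G x t) + H x t)"

lemma linear_kernel_gd_bracket:
  assumes f: "kernel J f" and g: "kernel J g"
  shows "linear_kernel i J (gd_bracket i f g)"
  unfolding linear_kernel_def
proof (intro allI)
  fix a b
  note o = pfuns_dual[OF kernel_pfuns[OF kernel_opp[OF f]], of a b] and f' = pfuns_dual[OF kernel_pfuns[OF f], of a b]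
    and g' = pfuns_dual[OF kernel_pfuns[OF g], of a b]
  have "\<forall>x t. gd_bracket i f g a b x (- x - t) = scale (t i) (opp f a b x (- x - t))
      + scale (x i) (f a b x (- x - t) + opp f a b x (- x - t)) + g a b x (- x - t)"
    by (simp add: gd_bracket_def algebra_simps)
  then show "\<exists>F\<in>pfuns J. \<exists>G\<in>pfuns J. \<exists>H\<in>pfuns J. \<forall>x t.
     gd_bracket i f g a b x (- x - t) = scale (t i) (F x t) + scale (x i) (G x t) + H x t"
    by (intro bexI[OF _ o] bexI[OF _ pfuns.add[OF f' o]] bexI[OF _ g'])
qed

lemma gd_bracket_inject:
  assumes f: "kernel J f" and g: "kernel J g" and f': "kernel J f'" and g': "kernel J g'" and i: "i \<notin> J"
    and eq: "gd_bracket i f g = gd_bracket i f' g'"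
  shows "f = f'" "g = g'"
proof -
  have *: "gd_bracket i f g a b (p(i := x)) (q(i := 0)) = gd_bracket i f' g' a b (p(i := x)) (q(i := 0))" for a b p q x
    using eq by simp
  show g_eq: "g = g'"
    using *[of _ _ _ 0]
    by (intro ext) (simp add: gd_bracket_def kernel_upd[OF g i] kernel_upd[OF g' i])
  show "f = f'"
    using *[of _ _ _ 1]
    by (intro ext) (simp add: gd_bracket_def kernel_upd[OF f i] kernel_upd[OF f' i] kernel_upd[OF g i] g_eq)
qed

text \<open>In terms of momenta a linear kernel is \<open>p\<^sub>i f + q\<^sub>i h + g\<close>; evaluating the \<open>i\<close>-th coordinates at \<open>0\<close> and \<open>1\<close>
  isolates the three parts. Skew symmetry exchanges the roles of \<open>p\<^sub>i\<close> and \<open>q\<^sub>i\<close>, hence determines \<open>h\<close> by \<open>f\<close>.\<close>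

lemma gd_bracket_of_linear_kernel:
  assumes L: "kernel I L" and lin: "linear_kernel i J L" and sk: "skew L"
    and i: "i \<notin> J" and I: "J \<subseteq> I" "i \<in> I"
  obtains f g where "kernel J f" "kernel J g" "L = gd_bracket i f g"
proof -
  define g where "g a b p q = L a b (p(i := 0)) (q(i := 0))" for a b p q
  define f where "f a b p q = L a b (p(i := 1)) (q(i := 0)) - g a b p q" for a b p q
  define h where "h a b p q = L a b (p(i := 0)) (q(i := 1)) - g a b p q" for a b p q
  have parts: "f a b \<in> pfuns J \<and> g a b \<in> pfuns J \<and>
      (\<forall>p q. L a b p q = scale (p i) (f a b p q) + scale (q i) (h a b p q) + g a b p q)" for a b
  proof -
    obtain F G H where *: "F \<in> pfuns J" "G \<in> pfuns J" "H \<in> pfuns J"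
      and eq: "\<And>x t. L a b x (- x - t) = scale (t i) (F x t) + scale (x i) (G x t) + H x t"
      using lin unfolding linear_kernel_def by meson
    (* Pass from the coordinates (x, t) to momenta: t = - p - q. *)
    define F' G' H' where "F' p q = F p (- p - q)" and "G' p q = G p (- p - q)" and "H' p q = H p (- p - q)" for p q
    have pf: "F' \<in> pfuns J" "G' \<in> pfuns J" "H' \<in> pfuns J"
      unfolding F'_def[abs_def] G'_def[abs_def] H'_def[abs_def] by (intro pfuns_dual *)+
    have eq': "L a b p q = scale (p i) (G' p q - F' p q) + scale (q i) (- F' p q) + H' p q" for p q
      using eq[of p "- p - q"] by (simp add: F'_def G'_def H'_def algebra_simps)
    have upd: "K (p(i := x)) (q(i := y)) = K p q" if "K \<in> pfuns J" for K :: "(nat \<Rightarrow> complex) \<Rightarrow> (nat \<Rightarrow> complex) \<Rightarrow> 'v" and p q x y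
      using that i by (intro pfuns_agree agree_upd)
    have "g a b = H'" "f a b = (\<lambda>p q. G' p q - F' p q)" "h a b = (\<lambda>p q. - F' p q)"
      by (auto simp: fun_eq_iff f_def g_def h_def eq' upd[OF pf(1)] upd[OF pf(2)] upd[OF pf(3)])
    then show ?thesis
      using pf by (auto simp: eq' intro: pfuns_diff)
  qed
  have g: "kernel J g"
  proof (rule kernelI)
    show "g a b p q \<in> V (\<alpha> + \<beta>)" if "a \<in> V \<alpha>" "b \<in> V \<beta>" for \<alpha> \<beta> a b p q
      unfolding g_def by (rule kernel_graded[OF L that])
    show "g a b \<in> pfuns J" for a b
      using parts by blast
  qed (simp_all add: g_def kernel_add[OF L] kernel_scale[OF L])
  have f: "kernel J f"
  proof (rule kernelI)
    show "f a b p q \<in> V (\<alpha> + \<beta>)" if "a \<in> V \<alpha>" "b \<in> V \<beta>" for \<alpha> \<beta> a b p q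
      unfolding f_def by (rule subspace_diff[OF subspace_V kernel_graded[OF L that] kernel_graded[OF g that]])
    show "f a b \<in> pfuns J" for a b
      using parts by blast
  qed (simp_all add: f_def kernel_add[OF L] kernel_scale[OF L] kernel_add[OF g] kernel_scale[OF g]
      scale_right_diff_distrib)
  have "L = gd_bracket i f g"
  proof (rule kernel_eqI[OF L kernel_gd_bracket[OF f g I]])
    fix \<alpha> \<beta> a b p q assume ab: "a \<in> V \<alpha>" "b \<in> V \<beta>"
    have skew: "L a b p q = - scale (sg \<alpha> \<beta>) (L b a q p)" for p q
      using sk ab unfolding skew_def by blast
    have "h a b p q = - scale (sg \<alpha> \<beta>) (f b a q p)"
      unfolding h_def f_def g_def by (simp add: skew scale_right_diff_distrib)
    then show "L a b p q = gd_bracket i f g a b p q"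
      using parts[of a b] by (simp add: gd_homogeneous[OF f ab])
  qed
  with f g show thesis by (rule that)
qed

text \<open>The polynomials \<open>F, G, H\<close> in the definition of \<open>i\<close>-linearity may be replaced by polynomial functions,
  by \<open>val2_pfuns\<close> and \<open>pfuns_val2\<close>.\<close>

lemma linear_iff:
  assumes L: "kernel I f" and B: "represents I B f"
  shows "(\<forall>a\<in>total_space V. \<forall>b\<in>total_space V.
        \<exists>F \<in> polys J (polys J (total_space V)).
        \<exists>G \<in> polys J (polys J (total_space V)).
        \<exists>H \<in> polys J (polys J (total_space V)).
          par_prod B (cst (cst a)) lam (cst (cst b)) =
            par_act (TT i) (psubst (pact scale) lam F) +
            par_act (lam i) (psubst (pact scale) lam G) +
            psubst (pact scale) lam H) \<longleftrightarrow> linear_kernel i J f"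
proof -
  have "par_prod B (cst (cst a)) lam (cst (cst b)) =
            par_act (TT i) (psubst (pact scale) lam F) +
            par_act (lam i) (psubst (pact scale) lam G) +
            psubst (pact scale) lam H \<longleftrightarrow>
     (\<forall>x t. f a b x (- x - t) = scale (t i) (val2 x t F) + scale (x i) (val2 x t G) + val2 x t H)" (is "?l \<longleftrightarrow> ?r")
    for a b F G H
  proof
    assume ?l
    show ?r
    proof (intro allI)
      fix x t
      from arg_cong[OF \<open>?l\<close>, of "val2 (case_sum x x) t"]
      show "f a b x (- x - t) = scale (t i) (val2 x t F) + scale (x i) (val2 x t G) + val2 x t H"
        by (simp add: val2_cprod_kernel[OF L B])
    qed
  next
    assume ?r
    then show ?l by (intro val2_eqI) (simp add: val2_cprod_kernel[OF L B])
  qed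
  moreover have "(\<exists>F\<in>polys J (polys J UNIV). P (\<lambda>x t. val2 x t F)) \<longleftrightarrow> (\<exists>F\<in>pfuns J. P F)"
    for P :: "((nat \<Rightarrow> complex) \<Rightarrow> (nat \<Rightarrow> complex) \<Rightarrow> 'v) \<Rightarrow> bool"
  proof
    assume "\<exists>F\<in>pfuns J. P F"
    then obtain F where F: "F \<in> pfuns J" "P F" by blast
    obtain R where "R \<in> polys J (polys J UNIV)" "\<And>x t. val2 x t R = F x t"
      using pfuns_val2[OF F(1)] by blast
    moreover from this(2) have "F = (\<lambda>x t. val2 x t R)" by (simp add: fun_eq_iff)
    ultimately show "\<exists>F\<in>polys J (polys J UNIV). P (\<lambda>x t. val2 x t F)"
      using F(2) by (intro bexI[of _ R]) simp_all
  qed (blast intro: val2_pfuns)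
  note this[of "\<lambda>F. \<exists>G\<in>pfuns J. \<exists>H\<in>pfuns J. \<forall>x t. g x t = scale (t i) (F x t) + scale (x i) (G x t) + H x t" for g]
    this[of "\<lambda>G. \<exists>H\<in>pfuns J. \<forall>x t. g x t = scale (t i) (F x t) + scale (x i) (G x t) + H x t" for g F]
    this[of "\<lambda>H. \<forall>x t. g x t = scale (t i) (F x t) + scale (x i) (G x t) + H x t" for g F G]
  ultimately show ?thesis
    by (simp add: total linear_kernel_def)
qed

lemma bracket_formula_iff:
  assumes f: "kernel J f" and N: "represents J N f" and g: "kernel J g" and K: "represents J K g"
    and l: "kernel I l" and L: "represents I L l" and I: "J \<subseteq> I" "i \<in> I"
  shows "bracket_formula i scale V N K L \<longleftrightarrow> gd_bracket i f g = l"
proof -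
  have *: "par_prod L (cst (cst a)) lam (cst (cst b)) =
            par_act (TT i) (par_act (ksign \<alpha> \<beta>) (par_prod N (cst (cst b)) (- lam - TT) (cst (cst a))))
          + par_act (lam i)
              (par_act (ksign \<alpha> \<beta>) (par_prod N (cst (cst b)) (- lam - TT) (cst (cst a)))
               + par_prod N (cst (cst a)) lam (cst (cst b)))
          + par_prod K (cst (cst a)) lam (cst (cst b)) \<longleftrightarrow>
      (\<forall>p q. l a b p q = gd_bracket i f g a b p q)" (is "?l \<longleftrightarrow> ?r")
    if ab: "a \<in> V \<alpha>" "b \<in> V \<beta>" for \<alpha> \<beta> a b
  proof
    assume ?l
    show ?r
    proof (intro allI)
      fix p q
      from arg_cong[OF \<open>?l\<close>, of "val2 (case_sum p p) (- p - q)"]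
      show "l a b p q = gd_bracket i f g a b p q"
        by (simp add: val2_cprod_kernel[OF l L] val2_cprod_kernel[OF f N] val2_cprod_kernel[OF g K]
            gd_homogeneous[OF f ab] algebra_simps)
    qed
  next
    assume ?r
    then show ?l
      by (intro val2_eqI, simp add: val2_cprod_kernel[OF l L] val2_cprod_kernel[OF f N] val2_cprod_kernel[OF g K]
            gd_homogeneous[OF f ab]) (simp add: algebra_simps)
  qed
  show ?thesis
    unfolding bracket_formula_def Let_def
  proof
    assume "\<forall>\<alpha> \<beta>. \<forall>a\<in>V \<alpha>. \<forall>b\<in>V \<beta>. par_prod L (cst (cst a)) lam (cst (cst b)) =
            par_act (TT i) (par_act (ksign \<alpha> \<beta>) (par_prod N (cst (cst b)) (- lam - TT) (cst (cst a))))
          + par_act (lam i)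
              (par_act (ksign \<alpha> \<beta>) (par_prod N (cst (cst b)) (- lam - TT) (cst (cst a)))
               + par_prod N (cst (cst a)) lam (cst (cst b)))
          + par_prod K (cst (cst a)) lam (cst (cst b))"
    then show "gd_bracket i f g = l"
      using * by (intro kernel_eqI[OF kernel_gd_bracket[OF f g I] l]) simp
  qed (use * in simp)
qed

lemma represents_UNIV_unique:
  assumes "represents I B f" "represents I B' f"
    and "conformal_product I (pact scale) (free_pieces I V) B" "conformal_product I (pact scale) (free_pieces I V) B'"
  shows "B = B'"
proof -
  have "B \<in> polys I UNIV \<rightarrow>\<^sub>E polys I UNIV \<rightarrow>\<^sub>E polys I (polys I UNIV)"
    if "conformal_product I (pact scale) (free_pieces I V) B" for B
    using that unfolding conformal_product_def total_space_free by (elim conjE)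
  from represents_unique[OF assms(1,2) this[OF assms(3)] this[OF assms(4)]] show ?thesis .
qed

text \<open>Membership in either set is a condition on kernels, and \<open>\<Phi>\<close> is \<open>gd_bracket\<close> on the level of kernels;
  so the bijection is assembled from \<open>skew_gd_iff\<close>, \<open>gd_jacobi_iff\<close>, \<open>gd_bracket_inject\<close> and
  \<open>gd_bracket_of_linear_kernel\<close>.\<close>

lemma gd_correspondence:
  assumes i: "i \<in> I"
  defines "J \<equiv> I - {i}"
  defines "\<Phi> \<equiv> \<lambda>(N, K). product_of I (gd_bracket i (kernel_of N) (kernel_of K))"
  shows "bij_betw \<Phi> (super_gelfand_dorfman_structures J scale V) (linear_lie_structures I i scale V)"
    and "\<And>N K L. (N, K) \<in> super_gelfand_dorfman_structures J scale V \<Longrightarrow>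
      L \<in> linear_lie_structures I i scale V \<Longrightarrow> \<Phi> (N, K) = L \<longleftrightarrow> bracket_formula i scale V N K L"
proof -
  have J: "J \<subseteq> I" "i \<notin> J" by (auto simp: J_def)
  let ?cp = "\<lambda>I. conformal_product I (pact scale) (free_pieces I V)"
  have lie_cp: "?cp I B" if "lie_conformal_superalgebra I (pact scale) (free_pieces I V) B" for I B
    using that unfolding lie_conformal_superalgebra_def by (rule conjunct1)
  have nov_cp: "?cp I B" if "novikov_conformal_superalgebra I (pact scale) (free_pieces I V) B" for I B
    using that unfolding novikov_conformal_superalgebra_def by (rule conjunct1)
  have S: "(N, K) \<in> super_gelfand_dorfman_structures J scale V \<longleftrightarrow> ?cp J N \<and> ?cp J K \<and>
     left_symmetric (kernel_of N) \<and> right_commutative (kernel_of N) \<and>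
     skew (kernel_of K) \<and> jacobi (kernel_of K) \<and> compatible (kernel_of N) (kernel_of K)" for N K
  proof (cases "?cp J N \<and> ?cp J K")
    case True
    then have N: "?cp J N" and K: "?cp J K" by auto
    note f = conformal_product_kernel[OF N] and g = conformal_product_kernel[OF K]
    show ?thesis
      unfolding super_gelfand_dorfman_structures_def mem_Collect_eq prod.case
        novikov_iff[OF f N] lie_iff[OF g K] compatible_iff[OF f g]
      using True by blast
  next
    case False
    then show ?thesis
      unfolding super_gelfand_dorfman_structures_def mem_Collect_eq prod.case
      using lie_cp nov_cp by blast
  qed
  have T: "L \<in> linear_lie_structures I i scale V \<longleftrightarrow> ?cp I L \<and>
     skew (kernel_of L) \<and> jacobi (kernel_of L) \<and> linear_kernel i J (kernel_of L)" for L
  proof (cases "?cp I L")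
    case True
    note f = conformal_product_kernel[OF True]
    show ?thesis
      unfolding linear_lie_structures_def J_def[symmetric] mem_Collect_eq lie_iff[OF f True] linear_iff[OF f]
      using True by blast
  next
    case False
    then show ?thesis
      unfolding linear_lie_structures_def mem_Collect_eq using lie_cp by blast
  qed
  have product: "?cp I (product_of I f)" "kernel_of (product_of I f) = f" if "kernel I f" for I f
    by (rule conformal_product_of[OF that], rule represents_kernel_of[OF represents_product_of[OF that]])
  have iff: "skew (gd_bracket i f g) \<and> jacobi (gd_bracket i f g) \<longleftrightarrow>
     left_symmetric f \<and> right_commutative f \<and> skew g \<and> jacobi g \<and> compatible f g"
    if "kernel J f" "kernel J g" for f g
    unfolding skew_gd_iff[OF that J(2)] using gd_jacobi_iff[OF that J(2)] by blast
  have gd: "kernel I (gd_bracket i f g)" if "kernel J f" "kernel J g" for f g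
    using kernel_gd_bracket[OF that J(1) i] .
  show "bij_betw \<Phi> (super_gelfand_dorfman_structures J scale V) (linear_lie_structures I i scale V)"
  proof (rule bij_betwI')
    fix X Y assume X: "X \<in> super_gelfand_dorfman_structures J scale V" and Y: "Y \<in> super_gelfand_dorfman_structures J scale V"
    obtain N K N' K' where XY: "X = (N, K)" "Y = (N', K')" by (metis surj_pair)
    have cp: "?cp J N" "?cp J K" "?cp J N'" "?cp J K'"
      using X Y unfolding XY S by simp_all
    note k = cp[THEN conformal_product_kernel(1)] and r = cp[THEN conformal_product_kernel(2)]
    show "\<Phi> X = \<Phi> Y \<longleftrightarrow> X = Y"
    proof
      assume "\<Phi> X = \<Phi> Y"
      from arg_cong[OF this, of kernel_of]
      have "gd_bracket i (kernel_of N) (kernel_of K) = gd_bracket i (kernel_of N') (kernel_of K')"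
        unfolding \<Phi>_def XY prod.case product(2)[OF gd[OF k(1,2)]] product(2)[OF gd[OF k(3,4)]] .
      note eq = gd_bracket_inject[OF k J(2) this]
      have "N = N'" "K = K'"
        using represents_UNIV_unique[OF r(1)[unfolded eq] r(3) cp(1,3)]
          represents_UNIV_unique[OF r(2)[unfolded eq] r(4) cp(2,4)] .
      then show "X = Y" by (simp add: XY)
    qed simp
  next
    fix X assume X: "X \<in> super_gelfand_dorfman_structures J scale V"
    obtain N K where XY: "X = (N, K)" by (rule prod.exhaust)
    have cp: "?cp J N" "?cp J K"
      using X unfolding XY S by simp_all
    note k = cp[THEN conformal_product_kernel(1)]
    show "\<Phi> X \<in> linear_lie_structures I i scale V"
      using X iff[OF k] linear_kernel_gd_bracket[OF k] product(1)[OF gd[OF k]]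
      unfolding T XY S \<Phi>_def prod.case product(2)[OF gd[OF k]] by blast
  next
    fix L assume L: "L \<in> linear_lie_structures I i scale V"
    then have L': "?cp I L" "skew (kernel_of L)" "jacobi (kernel_of L)" "linear_kernel i J (kernel_of L)"
      unfolding T by simp_all
    note k = conformal_product_kernel[OF L'(1)]
    obtain f g where fg: "kernel J f" "kernel J g" and eq: "kernel_of L = gd_bracket i f g"
      using gd_bracket_of_linear_kernel[OF k(1) L'(4,2) J(2,1) i] by blast
    let ?X = "(product_of J f, product_of J g)"
    have "?X \<in> super_gelfand_dorfman_structures J scale V"
      using iff[OF fg] L'(2,3) product(1)[OF fg(1)] product(1)[OF fg(2)]
      unfolding S eq product(2)[OF fg(1)] product(2)[OF fg(2)] by blast
    moreover have "\<Phi> ?X = L"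
      unfolding \<Phi>_def prod.case product(2)[OF fg(1)] product(2)[OF fg(2)]
      by (rule represents_UNIV_unique[OF represents_product_of[OF gd[OF fg]] k(2)[unfolded eq] product(1)[OF gd[OF fg]] L'(1)])
    ultimately show "\<exists>X\<in>super_gelfand_dorfman_structures J scale V. L = \<Phi> X"
      by (intro bexI[of _ ?X]) simp_all
  qed
  fix N K L assume NK: "(N, K) \<in> super_gelfand_dorfman_structures J scale V"
    and L: "L \<in> linear_lie_structures I i scale V"
  have cp: "?cp J N" "?cp J K" "?cp I L"
    using NK L unfolding S T by simp_all
  note k = cp[THEN conformal_product_kernel(1)] and r = cp[THEN conformal_product_kernel(2)]
  let ?G = "gd_bracket i (kernel_of N) (kernel_of K)"
  have "\<Phi> (N, K) = L \<longleftrightarrow> ?G = kernel_of L"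
  proof
    assume "\<Phi> (N, K) = L"
    from arg_cong[OF this, of kernel_of] show "?G = kernel_of L"
      unfolding \<Phi>_def prod.case product(2)[OF gd[OF k(1,2)]] .
  next
    assume "?G = kernel_of L"
    then have "represents I L ?G" using r(3) by simp
    then show "\<Phi> (N, K) = L"
      unfolding \<Phi>_def prod.case
      by (rule represents_UNIV_unique[OF represents_product_of[OF gd[OF k(1,2)]] _ product(1)[OF gd[OF k(1,2)]] cp(3)])
  qed
  also have "\<dots> \<longleftrightarrow> bracket_formula i scale V N K L"
    using bracket_formula_iff[OF k(1) r(1) k(2) r(2) k(3) r(3) J(1) i] by simp
  finally show "\<Phi> (N, K) = L \<longleftrightarrow> bracket_formula i scale V N K L" .
qed

end

theorem theorem3p1:
  fixes scale :: "complex \<Rightarrow> 'v::ab_group_add \<Rightarrow> 'v"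
    and V :: "bit \<Rightarrow> 'v set"
    and r i :: nat
  assumes "1 \<le> r" and "1 \<le> i" and "i \<le> r"
    and "vector_space scale" and "graded_module UNIV scale V" and "total_space V = UNIV"
  shows "\<exists>\<Phi>. bij_betw \<Phi> (super_gelfand_dorfman_structures ({1..r} - {i}) scale V)
                        (linear_lie_structures {1..r} i scale V) \<and>
           (\<forall>N K L. (N, K) \<in> super_gelfand_dorfman_structures ({1..r} - {i}) scale V \<longrightarrow>
              L \<in> linear_lie_structures {1..r} i scale V \<longrightarrow>
              (\<Phi> (N, K) = L \<longleftrightarrow> bracket_formula i scale V N K L))"
proof -
  interpret vector_space scale by fact
  interpret graded_space scale V
    by unfold_locales fact+
  have "i \<in> {1..r}" using assms by simp
  from gd_correspondence[OF this] show ?thesis by blast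
qed

end
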